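(* Let $n>2$ be an integer and let $\Upsilon = x_0+v\in\mathcal{A}_{n+1}$ be a hypercomplex number with scalar part $x_0>1$ and vector part $v$. Then the hypercomplex B-spline $B_\Upsilon$ satisfies the distributional differential equation $$\mathscr{D}^\Upsilon B_\Upsilon=\sum_{k=0}^\infty(-1)^k\binom{\Upsilon}{k}\,\delta(\cdot-k),$$ where $\delta$ denotes the Dirac distribution supported at $0$.
   Context: Clifford algebra. $C\ell(n)$ is the real Clifford algebra generated by the canonical basis $e_1,\dots,e_n$ of $\mathbb{R}^n$ with $e_ie_j+e_je_i=-2\delta_{ij}$, and $e_0:=1$. Hypercomplex numbers (paravectors) are the elements of $\mathcal{A}_{n+1}=\mathrm{span}_{\mathbb{R}}\{e_0,e_1,\dots,e_n\}$. Such an element is written $\Upsilon=x_0+v$, with scalar part $x_0\in\mathbb{R}$, vector part $v=\sum_{i=1}^n x_ie_i$ and $|v|=\sqrt{\sum_i x_i^2}$. Let $C\ell_{\mathbb{C}}(n)=C\ell(n)\otimes_{\mathbb{R}}\mathbb{C}$ with complex unit $i$ (commuting with the $e_j$), and $\mathcal{A}^{\mathbb{C}}_{n+1}=\mathrm{span}_{\mathbb{C}}\{e_0,\dots,e_n\}$. All functions below take values in the commutative subalgebra $\mathrm{span}_{\mathbb{C}}\{1,v\}\subset\mathcal{A}^{\mathbb{C}}_{n+1}$. Hypercomplex powers. For $z\in\mathbb{C}$, $z\neq 0$, $$z^\Upsilon:=z^{x_0}\left(\cos(|v|\log z)+\frac{v}{|v|}\sin(|v|\log z)\right),$$ where $\log$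 is the principal branch of the logarithm and $z^{x_0}=e^{x_0\log z}$. The term with $v/|v|$ is read as $0$ if $v=0$, and $0^\Upsilon:=0$ when $x_0>0$. Binomial coefficients. The hypercomplex Gamma function is $\Gamma(\Upsilon)=\int_0^\infty t^{\Upsilon-1}e^{-t}\,dt$ for $x_0>0$, extended by $\Gamma(\Upsilon+1)=\Upsilon\,\Gamma(\Upsilon)$. The hypercomplex binomial coefficient is $\binom{\Upsilon}{k}=\frac{\Gamma(\Upsilon+1)}{k!\,\Gamma(\Upsilon-k+1)}$, i.e. $\binom{\Upsilon}{k}=\frac{\Upsilon(\Upsilon-1)\cdots(\Upsilon-k+1)}{k!}$, with $\binom{\Upsilon}{0}=1$. Fourier transform. $\mathscr{F}f(\omega)=\widehat f(\omega)=\int_{\mathbb{R}}f(x)e^{-ix\omega}\,dx$, extended to tempered distributions (with values in $\mathcal{A}^{\mathbb{C}}_{n+1}$) in the usual way. Hypercomplex B-spline. For $x_0>1$, $B_\Upsilon$ is defined in the Fourier domain by $$\widehat{B}_\Upsilon(\omega)=\Omega(\omega)^\Upsilon,\qquad \Omega(\omega)=\frac{1-e^{-i\omega}}{i\omega},\quad \Omega(0):=1.$$ (The graph of $\Omega$ does not intersect the negative real axis.) Fractional derivative of hypercomplex order. $\mathscr{D}^\Upsilon$ is defined on distributions via the Fourier transform by $\mathscr{F}(\mathscr{D}^\Upsilon f)(\omega)=(i\omega)^\Upsilon\,\mathscr{F}f(\omega)$. Here it is applied to $f=B_\Upsilon$, for which the right-hand side is a well-defined function of polynomial growth. *)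

theory Defs
  imports "HOL-Analysis.Analysis"
begin

section \<open>The complexified Clifford algebra\<close>

text \<open>
  For an ordered index type \<open>'n\<close> with \<open>n = CARD('n)\<close>, an element of the complexified Clifford
  algebra is given by its coefficients with respect to the basis of ordered products
  \<open>e\<^sub>A = e\<^sub>i\<^sub>1 \<dots> e\<^sub>i\<^sub>k\<close> for \<open>A = {i\<^sub>1 < \<dots> < i\<^sub>k}\<close>. The real algebra consists of the elements with real
  coefficients. Beware that \<open>(*)\<close> and \<open>1\<close> on \<^typ>\<open>complex ^ 'n set\<close> are the componentwise
  operations; the Clifford product and unit are \<open>(\<odot>)\<close> and \<open>cl_one\<close> below, and the scalar
  actions are \<open>(*s)\<close> for complex numbers and \<open>(*\<^sub>R)\<close> for real numbers.
\<close>

type_synonym 'n cliff = "complex ^ 'n set"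

text \<open>
  Sorting \<open>e\<^sub>A e\<^sub>B\<close> gives one factor \<open>-1\<close> for every exchange of \<open>e\<^sub>i\<close>, \<open>i \<in> A\<close>, with
  \<open>e\<^sub>j\<close>, \<open>j \<in> B\<close>, \<open>j < i\<close>, and one for every \<open>i \<in> A \<inter> B\<close>, since \<open>e\<^sub>i e\<^sub>i = -1\<close>.
\<close>

definition cl_sign :: "'n::{finite,linorder} set \<Rightarrow> 'n set \<Rightarrow> complex" where
  "cl_sign A B = (\<Prod>i\<in>A. \<Prod>j\<in>B. if j \<le> i then -1 else 1)"

definition cl_mult :: "'n::{finite,linorder} cliff \<Rightarrow> 'n cliff \<Rightarrow> 'n cliff" (infixl \<open>\<odot>\<close> 70) where
  "a \<odot> b = (\<Sum>A\<in>UNIV. \<Sum>B\<in>UNIV. axis (sym_diff A B) (cl_sign A B * a $ A * b $ B))"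

definition cl_one :: "'n::{finite,linorder} cliff" where
  "cl_one = axis {} 1"

definition cl_gen :: "'n::{finite,linorder} \<Rightarrow> 'n cliff" where
  "cl_gen i = axis {i} 1"

text \<open>The following facts confirm that this is the intended algebra.\<close>

lemma cl_sign_empty [simp]: "cl_sign {} B = 1" "cl_sign A {} = 1"
  by (simp_all add: cl_sign_def)

lemma prod_sym_diff:
  fixes f :: "'a::finite \<Rightarrow> complex"
  assumes "\<And>i. f i * f i = 1"
  shows "prod f (sym_diff A B) = prod f A * prod f B"
proof -
  have sq: "prod f (A \<inter> B) * prod f (A \<inter> B) = 1"
    by (simp add: prod.distrib[symmetric] assms)
  have A: "prod f A = prod f (A - B) * prod f (A \<inter> B)"
    by (subst prod.union_disjoint[symmetric]) (auto intro: prod.cong)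
  have B: "prod f B = prod f (B - A) * prod f (A \<inter> B)"
    by (subst prod.union_disjoint[symmetric]) (auto intro: prod.cong)
  have "prod f (sym_diff A B) = prod f (A - B) * prod f (B - A)"
    by (rule prod.union_disjoint) auto
  also have "\<dots> = prod f (A - B) * prod f (B - A) * (prod f (A \<inter> B) * prod f (A \<inter> B))"
    by (simp add: sq)
  also have "\<dots> = prod f A * prod f B"
    by (simp add: A B mult_ac)
  finally show ?thesis .
qed

lemma cl_sign_sym_diff_left: "cl_sign (sym_diff A B) C = cl_sign A C * cl_sign B C"
  unfolding cl_sign_def
  by (rule prod_sym_diff) (auto simp: prod.distrib[symmetric] intro!: prod.neutral)

lemma cl_sign_sym_diff_right: "cl_sign A (sym_diff B C) = cl_sign A B * cl_sign A C"
  unfolding cl_sign_def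
  by (subst prod.distrib[symmetric], rule prod.cong[OF refl], rule prod_sym_diff) simp

lemma axis_add: "axis k (x + y) = axis k x + axis k (y :: complex)"
  by (simp add: vec_eq_iff axis_def)

lemma axis_zero [simp]: "axis k (0 :: complex) = 0"
  by (simp add: vec_eq_iff axis_def)

lemma axis_smult: "c *s axis k (x :: complex) = axis k (c * x)"
  by (simp add: vec_eq_iff axis_def)

lemma cl_expand: "a = (\<Sum>A\<in>UNIV. axis A (a $ A :: complex))"
  by (simp add: vec_eq_iff axis_def if_distrib sum.delta cong: if_cong)

lemma cl_mult_add_left: "(a + b) \<odot> c = a \<odot> c + b \<odot> c"
  by (simp add: cl_mult_def distrib_left distrib_right axis_add sum.distrib)

lemma cl_mult_add_right: "a \<odot> (b + c) = a \<odot> b + a \<odot> c"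
  by (simp add: cl_mult_def distrib_left distrib_right axis_add sum.distrib)

lemma cl_mult_smult_left: "(c *s a) \<odot> b = c *s (a \<odot> b)"
  by (simp add: cl_mult_def vec.scale_sum_right axis_smult mult_ac)

lemma cl_mult_smult_right: "a \<odot> (c *s b) = c *s (a \<odot> b)"
  by (simp add: cl_mult_def vec.scale_sum_right axis_smult mult_ac)

lemma cl_mult_zero [simp]: "0 \<odot> a = 0" "a \<odot> 0 = 0"
  by (simp_all add: cl_mult_def)

lemma cl_mult_sum_left: "sum f S \<odot> c = (\<Sum>x\<in>S. f x \<odot> c)"
  by (induction S rule: infinite_finite_induct) (simp_all add: cl_mult_add_left)

lemma cl_mult_sum_right: "c \<odot> sum f S = (\<Sum>x\<in>S. c \<odot> f x)"
  by (induction S rule: infinite_finite_induct) (simp_all add: cl_mult_add_right)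

lemma cl_mult_axis: "axis A x \<odot> axis B y = axis (sym_diff A B) (cl_sign A B * x * y)"
proof -
  have "axis A x \<odot> axis B y
      = (\<Sum>A'\<in>UNIV. \<Sum>B'\<in>UNIV. if B' = B then
           (if A' = A then axis (sym_diff A B) (cl_sign A B * x * y) else 0) else 0)"
    unfolding cl_mult_def
    by (intro sum.cong refl) (auto simp: axis_def[of _ x] axis_def[of _ y])
  then show ?thesis by simp
qed

lemma cl_mult_assoc: "(a \<odot> b) \<odot> c = a \<odot> (b \<odot> c)"
proof -
  have sd: "sym_diff (sym_diff A B) C = sym_diff A (sym_diff B C)" for A B C :: "'a set"
    by blast
  have axes: "(axis A x \<odot> axis B y) \<odot> axis C z = axis A x \<odot> (axis B y \<odot> axis C z)"
    for A B C :: "'a set" and x y z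
    by (simp only: cl_mult_axis sd cl_sign_sym_diff_left cl_sign_sym_diff_right mult_ac)
  show ?thesis
    by (subst (1 2) cl_expand[of a], subst (1 2) cl_expand[of b], subst (1 2) cl_expand[of c])
       (simp only: cl_mult_sum_left cl_mult_sum_right axes)
qed

lemma cl_one_left [simp]: "cl_one \<odot> a = a"
  by (subst (1 2) cl_expand[of a]) (simp add: cl_one_def cl_mult_sum_right cl_mult_axis)

lemma cl_one_right [simp]: "a \<odot> cl_one = a"
  by (subst (1 2) cl_expand[of a]) (simp add: cl_one_def cl_mult_sum_left cl_mult_axis)

lemma cl_gen_anticommute:
  "cl_gen i \<odot> cl_gen j + cl_gen j \<odot> cl_gen i = (if i = j then -2 else 0) *s cl_one"
proof (cases "i = j")
  case True
  then show ?thesis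
    by (simp add: cl_gen_def cl_one_def cl_mult_axis cl_sign_def axis_smult
        axis_add[symmetric])
next
  case False
  have "sym_diff {i} {j} = {i, j}" "sym_diff {j} {i} = {i, j}"
    using False by auto
  then show ?thesis
    using False
    by (auto simp: cl_gen_def cl_mult_axis cl_sign_def axis_add[symmetric])
qed

lemma cl_gen_mult_blade:
  assumes "\<And>j. j \<in> A \<Longrightarrow> i < j"
  shows "cl_gen i \<odot> axis A 1 = axis (insert i A) 1"
proof -
  have "sym_diff {i} A = insert i A" "cl_sign {i} A = 1"
    using assms by (auto simp: cl_sign_def not_le intro!: prod.neutral)
  then show ?thesis
    by (simp add: cl_gen_def cl_mult_axis)
qed


section \<open>Paravectors and hypercomplex powers\<close>

definition paravectors :: "'n::{finite,linorder} cliff set" where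
  "paravectors = span (insert cl_one (range cl_gen))"

definition cparavectors :: "'n::{finite,linorder} cliff set" where
  "cparavectors = vec.span (insert cl_one (range cl_gen))"

definition scalar_part :: "'n::{finite,linorder} cliff \<Rightarrow> real" where
  "scalar_part a = Re (a $ {})"

definition vector_part :: "'n::{finite,linorder} cliff \<Rightarrow> 'n cliff" where
  "vector_part a = (\<Sum>i\<in>UNIV. Re (a $ {i}) *\<^sub>R cl_gen i)"

definition vector_abs :: "'n::{finite,linorder} cliff \<Rightarrow> real" where
  "vector_abs a = sqrt (\<Sum>i\<in>UNIV. (Re (a $ {i}))\<^sup>2)"

lemma paravector_decomp:
  assumes "a \<in> paravectors"
  shows "a = scalar_part a *\<^sub>R cl_one + vector_part a"
  using assms unfolding paravectors_def
proof (induction rule: span_induct_alt)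
  case base
  show ?case by (simp add: scalar_part_def vector_part_def)
next
  case (step c x y)
  have x: "x = scalar_part x *\<^sub>R cl_one + vector_part x"
    using step(1)
  proof
    assume "x = cl_one"
    then show ?thesis
      by (simp add: scalar_part_def vector_part_def cl_one_def axis_def)
  next
    assume "x \<in> range cl_gen"
    then obtain i where i: "x = cl_gen i" by auto
    have "(\<Sum>j\<in>UNIV. Re (cl_gen i $ {j}) *\<^sub>R cl_gen j)
        = (\<Sum>j\<in>UNIV. if j = i then cl_gen i else (0 :: 'a cliff))"
      by (rule sum.cong) (auto simp: cl_gen_def axis_def)
    then show ?thesis
      by (simp add: i scalar_part_def vector_part_def) (simp add: cl_gen_def axis_def)
  qed
  have v: "vector_part (c *\<^sub>R x + y) = c *\<^sub>R vector_part x + vector_part y"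
    by (simp add: vector_part_def scaleR_add_left sum.distrib scaleR_sum_right)
  have s: "scalar_part (c *\<^sub>R x + y) = c * scalar_part x + scalar_part y"
    by (simp add: scalar_part_def)
  have "c *\<^sub>R x + y = c *\<^sub>R (scalar_part x *\<^sub>R cl_one + vector_part x)
      + (scalar_part y *\<^sub>R cl_one + vector_part y)"
    using x step(2) by simp
  also have "\<dots> = scalar_part (c *\<^sub>R x + y) *\<^sub>R cl_one + vector_part (c *\<^sub>R x + y)"
    unfolding v s by (simp add: algebra_simps)
  finally show ?case .
qed

text \<open>
  The logarithm is the principal branch. For vanishing vector part, division by zero makes the
  sine term vanish, as it should. The value at \<open>z = 0\<close> is only meant for positive scalar part.
\<close>

definition hpow :: "complex \<Rightarrow> 'n::{finite,linorder} cliff \<Rightarrow> 'n cliff" where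
  "hpow z \<Upsilon> =
     (if z = 0 then 0
      else (z powr of_real (scalar_part \<Upsilon>)) *s
             (cos (of_real (vector_abs \<Upsilon>) * ln z) *s cl_one +
              sin (of_real (vector_abs \<Upsilon>) * ln z) *s
                ((1 / vector_abs \<Upsilon>) *\<^sub>R vector_part \<Upsilon>)))"

text \<open>\<open>\<Upsilon> (\<Upsilon> - 1) \<dots> (\<Upsilon> - k + 1)\<close>, and the binomial coefficient \<open>\<Upsilon>\<close> over \<open>k\<close>.\<close>

primrec cl_ffact :: "'n::{finite,linorder} cliff \<Rightarrow> nat \<Rightarrow> 'n cliff" where
  "cl_ffact \<Upsilon> 0 = cl_one"
| "cl_ffact \<Upsilon> (Suc k) = cl_ffact \<Upsilon> k \<odot> (\<Upsilon> - real k *\<^sub>R cl_one)"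

definition hbinom :: "'n::{finite,linorder} cliff \<Rightarrow> nat \<Rightarrow> 'n cliff" where
  "hbinom \<Upsilon> k = (1 / fact k) *\<^sub>R cl_ffact \<Upsilon> k"


section \<open>Tempered distributions\<close>

definition nth_vderiv :: "nat \<Rightarrow> (real \<Rightarrow> complex) \<Rightarrow> real \<Rightarrow> complex" where
  "nth_vderiv k = (\<lambda>f x. vector_derivative f (at x)) ^^ k"

definition schwartz :: "(real \<Rightarrow> complex) set" where
  "schwartz = {\<phi>. (\<forall>k x. nth_vderiv k \<phi> differentiable (at x)) \<and>
                  (\<forall>m k. bounded (range (\<lambda>x. x ^ m *\<^sub>R nth_vderiv k \<phi> x)))}"

definition schwartz_seminorm :: "nat \<Rightarrow> nat \<Rightarrow> (real \<Rightarrow> complex) \<Rightarrow> real" where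
  "schwartz_seminorm m k \<phi> = (SUP x. norm (x ^ m *\<^sub>R nth_vderiv k \<phi> x))"

text \<open>
  A distribution is a functional on all functions which is \<open>0\<close> outside the Schwartz space, so that
  distributions are equal if and only if they agree on all Schwartz functions.
\<close>

type_synonym 'n distr = "(real \<Rightarrow> complex) \<Rightarrow> 'n cliff"

definition on_schwartz :: "'n::{finite,linorder} distr \<Rightarrow> 'n distr" where
  "on_schwartz T = (\<lambda>\<phi>. if \<phi> \<in> schwartz then T \<phi> else 0)"

definition tempered :: "'n::{finite,linorder} distr \<Rightarrow> bool" where
  "tempered T \<longleftrightarrow>
     on_schwartz T = T \<and>
     range T \<subseteq> cparavectors \<and>
     (\<forall>\<phi>\<in>schwartz. \<forall>\<psi>\<in>schwartz. \<forall>c. T (\<lambda>x. c * \<phi> x + \<psi> x) = c *s T \<phi> + T \<psi>) \<and>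
     (\<exists>N C. \<forall>\<phi>\<in>schwartz.
        norm (T \<phi>) \<le> C * (\<Sum>m\<le>N. \<Sum>k\<le>N. schwartz_seminorm m k \<phi>))"

definition fourier :: "(real \<Rightarrow> complex) \<Rightarrow> real \<Rightarrow> complex" where
  "fourier \<phi> \<omega> = (\<integral>x. \<phi> x * exp (- (\<i> * of_real x * of_real \<omega>)) \<partial>lborel)"

definition fourier_distr :: "'n::{finite,linorder} distr \<Rightarrow> 'n distr" where
  "fourier_distr T = on_schwartz (\<lambda>\<phi>. T (fourier \<phi>))"

definition poly_growth :: "(real \<Rightarrow> 'n::{finite,linorder} cliff) \<Rightarrow> bool" where
  "poly_growth g \<longleftrightarrow> g \<in> borel_measurable borel \<and> range g \<subseteq> cparavectors \<and>
     (\<exists>N C. \<forall>x. norm (g x) \<le> C * (1 + \<bar>x\<bar>) ^ N)"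

definition distr_of :: "(real \<Rightarrow> 'n::{finite,linorder} cliff) \<Rightarrow> 'n distr" where
  "distr_of g = on_schwartz (\<lambda>\<phi>. \<integral>x. \<phi> x *s g x \<partial>lborel)"

definition dirac :: "real \<Rightarrow> 'n::{finite,linorder} distr" where
  "dirac a = on_schwartz (\<lambda>\<phi>. \<phi> a *s cl_one)"

definition distr_mult :: "'n::{finite,linorder} cliff \<Rightarrow> 'n distr \<Rightarrow> 'n distr" where
  "distr_mult c T = (\<lambda>\<phi>. c \<odot> T \<phi>)"

text \<open>Convergence of a series of tempered distributions is weak-* convergence.\<close>

definition distr_sums :: "(nat \<Rightarrow> 'n::{finite,linorder} distr) \<Rightarrow> 'n distr \<Rightarrow> bool"
    (infix \<open>distr'_sums\<close> 80) where
  "T distr_sums S \<longleftrightarrow>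
     (\<forall>k. tempered (T k)) \<and> tempered S \<and> (\<forall>\<phi>\<in>schwartz. (\<lambda>k. T k \<phi>) sums S \<phi>)"


section \<open>Hypercomplex B-splines and fractional derivatives\<close>

definition Omega :: "real \<Rightarrow> complex" where
  "Omega \<omega> = (if \<omega> = 0 then 1 else (1 - exp (- (\<i> * of_real \<omega>))) / (\<i> * of_real \<omega>))"

definition bspline :: "'n::{finite,linorder} cliff \<Rightarrow> 'n distr" where
  "bspline \<Upsilon> =
     (THE B. tempered B \<and> fourier_distr B = distr_of (\<lambda>\<omega>. hpow (Omega \<omega>) \<Upsilon>))"

text \<open>
  The product of \<open>(i\<omega>)\<close> to the power \<open>\<Upsilon>\<close> with the Fourier transform of \<open>f\<close> is formed pointwise. It is
  used for those \<open>f\<close> only whose Fourier transform is a function \<open>g\<close> such that this product, too,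
  is of polynomial growth.
\<close>

definition frac_deriv ::
    "'n::{finite,linorder} cliff \<Rightarrow> 'n distr \<Rightarrow> 'n distr" where
  "frac_deriv \<Upsilon> f =
     (THE D. tempered D \<and>
        (\<exists>g. poly_growth g \<and> fourier_distr f = distr_of g \<and>
             poly_growth (\<lambda>\<omega>. hpow (\<i> * of_real \<omega>) \<Upsilon> \<odot> g \<omega>) \<and>
             fourier_distr D = distr_of (\<lambda>\<omega>. hpow (\<i> * of_real \<omega>) \<Upsilon> \<odot> g \<omega>)))"

end

theory Submission
  imports Defs "HOL-Probability.Characteristic_Functions" "HOL-Probability.Sinc_Integral"
    "HOL-Complex_Analysis.Cauchy_Integral_Theorem"
begin

text \<open>
  The subalgebra generated by \<open>1\<close> and \<open>v\<close> has orthogonal idempotents \<open>P\<close>, \<open>Q\<close> with \<open>P + Q = 1\<close> and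
  \<open>\<Upsilon> = l P + m Q\<close>, where \<open>l, m = x\<^sub>0 \<plusminus> \<i>|v|\<close>. Powers and binomial coefficients of \<open>\<Upsilon>\<close> are taken
  separately in both components, which reduces everything to complex exponents \<open>a\<close> with positive real
  part. For these, \<open>(\<i>\<omega>)\<^sup>a \<Omega>(\<omega>)\<^sup>a = (1 - e\<^sup>-\<^sup>\<i>\<^sup>\<omega>)\<^sup>a\<close> is the binomial series on the unit circle. It
  converges absolutely, so it can be integrated termwise against a Schwartz function, and
  \<open>e\<^sup>-\<^sup>\<i>\<^sup>k\<^sup>\<omega>\<close> is the Fourier transform of the Dirac distribution at \<open>k\<close>.

  The definite descriptions are well defined since the Fourier transform is a bijection of the Schwartz
  space and since a function of polynomial growth is determined almost everywhere by its distribution.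
\<close>

section \<open>The Schwartz space\<close>

text \<open>The main obstacle is that \<open>frac_deriv\<close> asks for some \<open>g\<close>
  representing the transform of the spline, so that \<open>g\<close> is known only up to a null set,
  while the product with the power of \<open>\<i> * of_real \<omega>\<close> is formed pointwise.
  Existence rests on explicit candidates whose transforms are bounded:
  \<open>norm (Omega \<omega>) \<le> 1\<close>, and the product is a power of a number of modulus at
  most 2, so the growing factor \<open>(\<i> * of_real \<omega>) powr a\<close> is never estimated
  alone. The imaginary part of an exponent contributes only a factor exp (- Im a Arg z), bounded
  because the principal argument is. Absolute convergence of the binomial series comes from
  \<open>norm (a gchoose k)\<close> being O(k^(- Re a - 1)); the Dirac series is then continuous
  already for the supremum norm. The binomial theorem is carried from the open disc to the circle by
  a limit along radii, except at the point -1, which corresponds to \<omega> in 2 \<pi> Z, a null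
  set.\<close>

lemma nth_vderiv_0 [simp]: "nth_vderiv 0 f = f"
  by (simp add: nth_vderiv_def)

lemma nth_vderiv_Suc: "nth_vderiv (Suc k) f = (\<lambda>x. vector_derivative (nth_vderiv k f) (at x))"
  by (simp add: nth_vderiv_def)

lemma nth_vderiv_Suc_shift: "nth_vderiv k (\<lambda>x. vector_derivative f (at x)) = nth_vderiv (Suc k) f"
  unfolding nth_vderiv_def funpow_Suc_right by simp

text \<open>Both closure conditions can be iterated: the derivatives of \<open>f\<close> stay in
  \<open>X\<close>, and so do their products with powers of \<open>x\<close>, which are therefore
  bounded. Membership then needs only a suitable family \<open>X\<close> and first derivatives, no
  formula for the higher ones.\<close>

lemma schwartz_coinduct:
  assumes f: "f \<in> X"
    and bounded: "\<And>f. f \<in> X \<Longrightarrow> bounded (range f)"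
    and deriv: "\<And>f. f \<in> X \<Longrightarrow> \<exists>f'\<in>X. \<forall>x. (f has_vector_derivative f' x) (at x)"
    and mult: "\<And>f. f \<in> X \<Longrightarrow> (\<lambda>x. x *\<^sub>R f x) \<in> X"
  shows "f \<in> schwartz"
proof -
  have vd: "(\<lambda>x. vector_derivative g (at x)) \<in> X \<and> (\<forall>x. g differentiable (at x))"
    if g: "g \<in> X" for g
  proof -
    from deriv[OF g] obtain g' where g': "g' \<in> X" "\<And>x. (g has_vector_derivative g' x) (at x)"
      by blast
    have "(\<lambda>x. vector_derivative g (at x)) = g'"
      using g'(2) by (auto intro: vector_derivative_at)
    with g' show ?thesis by (auto intro: differentiableI_vector)
  qed
  have n: "nth_vderiv k f \<in> X" for k
    by (induction k) (use f vd in \<open>auto simp: nth_vderiv_Suc\<close>)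
  have m: "(\<lambda>x. x ^ m *\<^sub>R g x) \<in> X" if "g \<in> X" for g m
  proof (induction m)
    case (Suc m)
    from mult[OF this] show ?case by simp
  qed (use that in simp)
  show ?thesis
    unfolding schwartz_def using vd[OF n] bounded[OF m[OF n]] by blast
qed

lemma schwartz_has_vector_derivative:
  "f \<in> schwartz \<Longrightarrow> (f has_vector_derivative vector_derivative f (at x)) (at x)"
  unfolding schwartz_def mem_Collect_eq
  by (metis nth_vderiv_0 vector_derivative_works)

lemma schwartz_vderiv: "f \<in> schwartz \<Longrightarrow> (\<lambda>x. vector_derivative f (at x)) \<in> schwartz"
  unfolding schwartz_def mem_Collect_eq by (simp add: nth_vderiv_Suc_shift)

lemma schwartz_nth_vderiv: "f \<in> schwartz \<Longrightarrow> nth_vderiv k f \<in> schwartz"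
  by (induction k) (simp_all add: nth_vderiv_Suc schwartz_vderiv)

lemma schwartz_bdd_above:
  "f \<in> schwartz \<Longrightarrow> bdd_above (range (\<lambda>x. norm (x ^ m *\<^sub>R nth_vderiv k f x)))"
  by (auto simp: schwartz_def bdd_above_norm[symmetric] image_comp comp_def)

lemma schwartz_bound:
  assumes "f \<in> schwartz"
  shows "norm (x ^ m *\<^sub>R nth_vderiv k f x) \<le> schwartz_seminorm m k f"
  unfolding schwartz_seminorm_def using schwartz_bdd_above[OF assms] by (intro cSUP_upper) auto

lemma schwartz_norm_le: "f \<in> schwartz \<Longrightarrow> norm (f x) \<le> schwartz_seminorm 0 0 f"
  using schwartz_bound[of f x 0 0] by simp

lemma schwartz_bounded_pow:
  assumes "f \<in> schwartz"
  shows "bounded (range (\<lambda>x. x ^ m *\<^sub>R f x))"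
proof -
  have "bounded (range (\<lambda>x. x ^ m *\<^sub>R nth_vderiv 0 f x))"
    using assms unfolding schwartz_def mem_Collect_eq by blast
  then show ?thesis by simp
qed

lemma bounded_range_lincomb:
  fixes f g :: "real \<Rightarrow> complex"
  assumes "bounded (range f)" "bounded (range g)"
  shows "bounded (range (\<lambda>x. c * f x + g x))"
proof -
  obtain a b where ab: "\<And>x. norm (f x) \<le> a" "\<And>x. norm (g x) \<le> b"
    using assms by (auto simp: bounded_iff)
  have "norm (c * f x + g x) \<le> norm c * a + b" for x
    by (rule order_trans[OF norm_triangle_ineq])
       (auto simp: norm_mult intro!: add_mono mult_left_mono ab)
  then show ?thesis by (auto simp: bounded_iff)
qed

text \<open>Leibniz's rule, with only two terms because the second derivative of \<open>x\<close>
  vanishes. At \<open>k = 0\<close> the truncated \<open>k - 1\<close> is harmless because its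
  coefficient is 0. The computation is done by hand since closure under multiplication by
  \<open>x\<close> is what the later coinductive families built from \<open>schwartz\<close> rely
  on.\<close>

lemma nth_vderiv_mult_x:
  assumes f: "f \<in> schwartz"
  shows "nth_vderiv k (\<lambda>x. x *\<^sub>R f x) = (\<lambda>x. x *\<^sub>R nth_vderiv k f x + of_nat k *\<^sub>R nth_vderiv (k - 1) f x)
    \<and> (\<forall>x. nth_vderiv k (\<lambda>x. x *\<^sub>R f x) differentiable (at x))"
proof (induction k)
  case 0
  have "(f has_vector_derivative vector_derivative f (at x)) (at x)" for x
    by (rule schwartz_has_vector_derivative[OF f])
  then have "f differentiable (at x)" for x by (rule differentiableI_vector)
  then show ?case by (simp add: differentiable_scaleR)
next
  case (Suc k)
  have d: "(nth_vderiv j f has_vector_derivative nth_vderiv (Suc j) f x) (at x)" for j x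
    using schwartz_has_vector_derivative[OF schwartz_nth_vderiv[OF f]] by (simp add: nth_vderiv_Suc)
  have "((\<lambda>x. x *\<^sub>R nth_vderiv k f x + of_nat k *\<^sub>R nth_vderiv (k - 1) f x) has_vector_derivative
         (x *\<^sub>R nth_vderiv (Suc k) f x + of_nat (Suc k) *\<^sub>R nth_vderiv k f x)) (at x)" for x
    by (rule derivative_eq_intros d refl)+ (cases k; simp add: scaleR_conv_of_real algebra_simps)
  then have eq: "nth_vderiv (Suc k) (\<lambda>x. x *\<^sub>R f x)
      = (\<lambda>x. x *\<^sub>R nth_vderiv (Suc k) f x + of_nat (Suc k) *\<^sub>R nth_vderiv k f x)"
    using Suc.IH by (auto simp: nth_vderiv_Suc[of k] intro!: vector_derivative_at)
  have "(\<lambda>x. x *\<^sub>R nth_vderiv (Suc k) f x + of_nat (Suc k) *\<^sub>R nth_vderiv k f x) differentiable (at x)" for x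
    by (intro derivative_intros differentiableI_vector[OF d])
  with eq show ?case by simp
qed

lemma schwartz_mult_x:
  assumes f: "f \<in> schwartz"
  shows "(\<lambda>x. x *\<^sub>R f x) \<in> schwartz"
proof -
  have "bounded (range (\<lambda>x. x ^ m *\<^sub>R nth_vderiv k (\<lambda>x. x *\<^sub>R f x) x))" for m k
  proof -
    have "bounded (range (\<lambda>x. complex_of_real (real k) * (x ^ m *\<^sub>R nth_vderiv (k - 1) f x)
       + x ^ Suc m *\<^sub>R nth_vderiv k f x))"
      by (intro bounded_range_lincomb schwartz_bounded_pow schwartz_nth_vderiv f)
    then show ?thesis
      using nth_vderiv_mult_x[OF f, of k] by (simp add: scaleR_conv_of_real algebra_simps)
  qed
  then show ?thesis
    using nth_vderiv_mult_x[OF f] unfolding schwartz_def by blast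
qed

lemma schwartz_lincomb:
  assumes "f \<in> schwartz" "g \<in> schwartz"
  shows "(\<lambda>x. c * f x + g x) \<in> schwartz"
proof (rule schwartz_coinduct[of _ "{\<lambda>x. c * h x + k x | h k. h \<in> schwartz \<and> k \<in> schwartz}"];
    (elim CollectE exE conjE)?; simp?)
  show "\<exists>h k. (\<lambda>x. c * f x + g x) = (\<lambda>x. c * h x + k x) \<and> h \<in> schwartz \<and> k \<in> schwartz"
    using assms by blast
next
  fix h k assume hk: "h \<in> schwartz" "k \<in> schwartz"
  show "bounded (range (\<lambda>x. c * h x + k x))"
    using schwartz_bounded_pow[OF hk(1), of 0] schwartz_bounded_pow[OF hk(2), of 0]
    by (intro bounded_range_lincomb) simp_all
  show "\<exists>f'. (\<exists>h k. f' = (\<lambda>x. c * h x + k x) \<and> h \<in> schwartz \<and> k \<in> schwartz) \<and>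
     (\<forall>x. ((\<lambda>x. c * h x + k x) has_vector_derivative f' x) (at x))"
    using schwartz_vderiv[OF hk(1)] schwartz_vderiv[OF hk(2)]
    by (intro exI[of _ "\<lambda>x. c * vector_derivative h (at x) + vector_derivative k (at x)"] conjI allI
        exI[of _ "\<lambda>x. vector_derivative h (at x)"] exI[of _ "\<lambda>x. vector_derivative k (at x)"] refl
        has_vector_derivative_add has_vector_derivative_mult_right
        schwartz_has_vector_derivative hk)
  show "\<exists>h' k'. (\<lambda>x. x *\<^sub>R (c * h x + k x)) = (\<lambda>x. c * h' x + k' x) \<and> h' \<in> schwartz \<and> k' \<in> schwartz"
    by (rule exI[of _ "\<lambda>x. x *\<^sub>R h x"], rule exI[of _ "\<lambda>x. x *\<^sub>R k x"])
       (use hk in \<open>simp add: schwartz_mult_x algebra_simps\<close>)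
qed

lemma schwartz_zero: "(\<lambda>x. 0) \<in> schwartz"
  by (rule schwartz_coinduct[of _ "{\<lambda>x. 0}"]) auto

lemma schwartz_cmult: "f \<in> schwartz \<Longrightarrow> (\<lambda>x. c * f x) \<in> schwartz"
  using schwartz_lincomb[OF _ schwartz_zero] by simp

lemma schwartz_reflect:
  assumes "f \<in> schwartz"
  shows "(\<lambda>x. f (- x)) \<in> schwartz"
proof (rule schwartz_coinduct[of _ "{\<lambda>x. h (- x) | h. h \<in> schwartz}"];
    (elim CollectE exE conjE)?; simp?)
  show "\<exists>h. (\<lambda>x. f (- x)) = (\<lambda>x. h (- x)) \<and> h \<in> schwartz"
    using assms by blast
next
  fix h assume h: "h \<in> schwartz"
  show "bounded (range (\<lambda>x. h (- x)))"
    using schwartz_bounded_pow[OF h, of 0] by (auto simp: bounded_iff)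
  have "((\<lambda>x. h (- x)) has_vector_derivative (- 1) *\<^sub>R vector_derivative h (at (- x))) (at x)" for x
    using vector_diff_chain_at[OF has_vector_derivative_minus[OF has_vector_derivative_id]
        schwartz_has_vector_derivative[OF h]]
    by (simp add: comp_def)
  then show "\<exists>f'. (\<exists>h. f' = (\<lambda>x. h (- x)) \<and> h \<in> schwartz) \<and>
     (\<forall>x. ((\<lambda>x. h (- x)) has_vector_derivative f' x) (at x))"
    by (intro exI[of _ "\<lambda>x. (- 1) *\<^sub>R vector_derivative h (at (- x))"] conjI allI
         exI[of _ "\<lambda>x. (- 1) * vector_derivative h (at x)"])
       (auto intro!: schwartz_cmult[of _ "-1", simplified] schwartz_vderiv h)
  show "\<exists>h'. (\<lambda>x. x *\<^sub>R h (- x)) = (\<lambda>x. h' (- x)) \<and> h' \<in> schwartz"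
    by (rule exI[of _ "\<lambda>x. (- 1) * (x *\<^sub>R h x)"])
       (use schwartz_cmult[OF schwartz_mult_x[OF h], of "-1"] in simp)
qed

lemma schwartz_continuous_on: "f \<in> schwartz \<Longrightarrow> continuous_on A f"
  using schwartz_has_vector_derivative[THEN has_vector_derivative_continuous]
  by (simp add: continuous_at_imp_continuous_on)

lemma schwartz_measurable [measurable (raw)]: "f \<in> schwartz \<Longrightarrow> f \<in> borel_measurable borel"
  by (intro borel_measurable_continuous_onI schwartz_continuous_on)

section \<open>Decay and integrability of Schwartz functions\<close>

lemma integrable_inverse_1_plus_square_lborel: "integrable lborel (\<lambda>x::real. inverse (1 + x\<^sup>2))"
  using integrable_inverse_1_plus_square by (simp add: set_integrable_def)

lemma integral_inverse_1_plus_square_lborel: "(\<integral>x. inverse (1 + x\<^sup>2) \<partial>(lborel :: real measure)) = pi"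
  using LBINT_inverse_1_plus_square by (simp add: interval_lebesgue_integral_def set_lebesgue_integral_def)

text \<open>The seminorms of orders 0 and 2 in \<open>x\<close> together control
  \<open>(1 + x\<^sup>2) * norm (f x)\<close>. The majorant has integral \<pi> over the line, whence
  the factor \<open>pi\<close> in the bounds below.\<close>

lemma schwartz_decay:
  assumes f: "f \<in> schwartz"
  shows "norm (f x) \<le> (schwartz_seminorm 0 0 f + schwartz_seminorm 2 0 f) * inverse (1 + x\<^sup>2)"
proof -
  have "(1 + x\<^sup>2) * norm (f x) \<le> schwartz_seminorm 0 0 f + schwartz_seminorm 2 0 f"
    using schwartz_bound[OF f, of x 0 0] schwartz_bound[OF f, of x 2 0] by (simp add: algebra_simps)
  then show ?thesis
    by (simp add: field_simps add_pos_nonneg)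
qed

lemma schwartz_integrable:
  assumes f: "f \<in> schwartz"
  shows "integrable lborel f"
proof (rule Bochner_Integration.integrable_bound[OF
      integrable_mult_right[OF integrable_inverse_1_plus_square_lborel]])
  show "f \<in> borel_measurable lborel" using f by (simp add: schwartz_measurable)
  show "AE x in lborel. norm (f x) \<le>
      norm ((schwartz_seminorm 0 0 f + schwartz_seminorm 2 0 f) * inverse (1 + x\<^sup>2))"
    by (rule AE_I2, rule order_trans[OF schwartz_decay[OF f]]) simp
qed

lemma schwartz_L1_le:
  assumes f: "f \<in> schwartz"
  shows "(\<integral>x. norm (f x) \<partial>lborel) \<le> pi * (schwartz_seminorm 0 0 f + schwartz_seminorm 2 0 f)"
proof -
  have "(\<integral>x. norm (f x) \<partial>lborel) \<le>
    (\<integral>x. (schwartz_seminorm 0 0 f + schwartz_seminorm 2 0 f) * inverse (1 + x\<^sup>2) \<partial>lborel)"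
    by (intro integral_mono integrable_mult_right integrable_norm schwartz_integrable f
        integrable_inverse_1_plus_square_lborel schwartz_decay)
  then show ?thesis
    by (simp only: integral_mult_right_zero integral_inverse_1_plus_square_lborel mult.commute[of pi])
qed

section \<open>The Fourier transform on the Schwartz space\<close>

lemma norm_fourier_kernel [simp]: "norm (exp (- (\<i> * complex_of_real x * complex_of_real \<omega>))) = 1"
  by (simp add: norm_exp_eq_Re)

lemma fourier_kernel_measurable [measurable]:
  "(\<lambda>x. exp (- (\<i> * complex_of_real x * complex_of_real \<omega>))) \<in> borel_measurable borel"
  by (intro borel_measurable_continuous_onI continuous_intros)

lemma integrable_mult_fourier_kernel:
  fixes f :: "real \<Rightarrow> complex"
  assumes f: "integrable lborel f"
  shows "integrable lborel (\<lambda>x. f x * exp (- (\<i> * of_real x * of_real \<omega>)))"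
  by (rule Bochner_Integration.integrable_bound[OF f]) (use f in \<open>auto simp: norm_mult\<close>)

lemma norm_fourier_le: "norm (fourier f \<omega>) \<le> (\<integral>x. norm (f x) \<partial>lborel)"
  unfolding fourier_def by (rule order_trans[OF integral_norm_bound]) (simp add: norm_mult)

lemma norm_exp_i_minus_linear_le: "cmod (exp (- (\<i> * of_real t)) - 1 + \<i> * of_real t) \<le> t\<^sup>2 / 2"
  using iexp_approx1[of "- t" 1] by (simp add: power2_eq_square algebra_simps)

lemma schwartz_mult_i_x:
  assumes "f \<in> schwartz"
  shows "(\<lambda>x. - \<i> * of_real x * f x) \<in> schwartz"
  using schwartz_cmult[OF schwartz_mult_x[OF assms], of "- \<i>"] by (simp add: scaleR_conv_of_real mult.assoc)

text \<open>Differentiation under the integral sign in quantitative form: the second-order Taylor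
  estimate of the kernel bounds the remainder by \<open>M * h\<^sup>2\<close>, where
  \<open>M\<close> is the L1 norm of \<open>x\<^sup>2\<close> times \<open>f\<close>, finite because
  that function is Schwartz again.\<close>

lemma fourier_has_vector_derivative:
  assumes f: "f \<in> schwartz"
  shows "(fourier f has_vector_derivative fourier (\<lambda>x. - \<i> * of_real x * f x) \<omega>) (at \<omega>)"
proof -
  define f1 where "f1 = (\<lambda>x. - \<i> * of_real x * f x)"
  define M where "M = (\<integral>x. norm (x *\<^sub>R (x *\<^sub>R f x)) \<partial>lborel)"
  let ?e = "\<lambda>x \<omega>. exp (- (\<i> * complex_of_real x * complex_of_real \<omega>))"
  have f1: "f1 \<in> schwartz" unfolding f1_def by (rule schwartz_mult_i_x[OF f])
  note int = integrable_mult_fourier_kernel[OF schwartz_integrable[OF f]]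
    integrable_mult_fourier_kernel[OF schwartz_integrable[OF f1]]
  have M: "integrable lborel (\<lambda>x. norm (x *\<^sub>R (x *\<^sub>R f x)))"
    by (intro integrable_norm schwartz_integrable schwartz_mult_x f)
  have est: "norm (fourier f (\<omega> + h) - fourier f \<omega> - h *\<^sub>R fourier f1 \<omega>) \<le> M * h\<^sup>2" for h
  proof -
    have pt: "norm (f x * ?e x (\<omega> + h) - f x * ?e x \<omega> - h *\<^sub>R (f1 x * ?e x \<omega>))
        \<le> h\<^sup>2 * norm (x *\<^sub>R (x *\<^sub>R f x))" for x
    proof -
      have eq: "f x * ?e x (\<omega> + h) - f x * ?e x \<omega> - h *\<^sub>R (f1 x * ?e x \<omega>)
          = f x * ?e x \<omega> * (exp (- (\<i> * of_real (x * h))) - 1 + \<i> * of_real (x * h))"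
        by (simp add: f1_def algebra_simps exp_add exp_diff exp_minus scaleR_conv_of_real divide_inverse)
      have "norm (f x) * cmod (exp (- (\<i> * of_real (x * h))) - 1 + \<i> * of_real (x * h))
         \<le> norm (f x) * ((x * h)\<^sup>2 / 2)"
        by (intro mult_left_mono norm_exp_i_minus_linear_le) simp
      also have "\<dots> \<le> norm (f x) * ((x * h)\<^sup>2)"
        by (intro mult_left_mono) auto
      also have "\<dots> = h\<^sup>2 * norm (x *\<^sub>R (x *\<^sub>R f x))"
        by (simp add: power2_eq_square abs_mult[symmetric] ac_simps del: abs_mult_self_eq)
      finally show ?thesis unfolding eq by (simp add: norm_mult)
    qed
    have "fourier f (\<omega> + h) - fourier f \<omega> - h *\<^sub>R fourier f1 \<omega> =
      (\<integral>x. f x * ?e x (\<omega> + h) - f x * ?e x \<omega> - h *\<^sub>R (f1 x * ?e x \<omega>) \<partial>lborel)"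
      unfolding fourier_def using int
      by (simp add: Bochner_Integration.integral_diff Bochner_Integration.integrable_diff
          del: of_real_add)
    also have "norm \<dots> \<le> (\<integral>x. h\<^sup>2 * norm (x *\<^sub>R (x *\<^sub>R f x)) \<partial>lborel)"
      by (rule Bochner_Integration.integral_norm_bound_integral)
         (use pt M int in \<open>auto intro!: Bochner_Integration.integrable_diff simp del: of_real_add\<close>)
    finally show ?thesis by (simp add: M_def mult.commute)
  qed
  have "((\<lambda>h. norm (fourier f (\<omega> + h) - fourier f \<omega> - h *\<^sub>R fourier f1 \<omega>) / norm h) \<longlongrightarrow> 0) (at 0)"
  proof (rule tendsto_sandwich[of "\<lambda>_. 0" _ _ "\<lambda>h. M * norm h"])
    show "\<forall>\<^sub>F h in at 0. norm (fourier f (\<omega> + h) - fourier f \<omega> - h *\<^sub>R fourier f1 \<omega>) / norm h \<le> M * norm h"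
      using est by (auto simp: eventually_at_filter power2_eq_square divide_simps mult.assoc)
    show "((\<lambda>h. M * norm h) \<longlongrightarrow> 0) (at (0::real))"
      by (rule tendsto_eq_intros refl)+ simp
  qed auto
  then show ?thesis
    unfolding has_vector_derivative_def has_derivative_at f1_def[symmetric]
    by (auto intro: bounded_linear_scaleR_left)
qed

lemma schwartz_tendsto_0:
  assumes f: "f \<in> schwartz" and F: "F = at_top \<or> F = at_bot"
  shows "(f \<longlongrightarrow> 0) F"
proof (rule Lim_null_comparison)
  let ?C = "schwartz_seminorm 0 0 f + schwartz_seminorm 2 0 f"
  show "\<forall>\<^sub>F x in F. norm (f x) \<le> ?C * inverse (1 + x\<^sup>2)"
    using schwartz_decay[OF f] by simp
  have "filterlim (\<lambda>x::real. 1 + x\<^sup>2) at_infinity F"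
    using F
  proof
    assume "F = at_top"
    then show ?thesis
      by (auto intro!: filterlim_at_top_imp_at_infinity filterlim_tendsto_add_at_top[OF tendsto_const]
        filterlim_pow_at_top filterlim_ident)
  next
    assume "F = at_bot"
    then show ?thesis
      by (auto intro!: filterlim_at_top_imp_at_infinity filterlim_tendsto_add_at_top[OF tendsto_const]
        filterlim_pow_at_bot_even filterlim_ident)
  qed
  then show "((\<lambda>x. ?C * inverse (1 + x\<^sup>2)) \<longlongrightarrow> 0) F"
    by (intro tendsto_mult_right_zero filterlim_compose[OF tendsto_inverse_0])
qed

text \<open>The fundamental theorem of calculus on the whole line. Applied to a product vanishing at
  both ends, it is integration by parts without boundary terms.\<close>

lemma integral_vderiv_eq_0:
  fixes F :: "real \<Rightarrow> complex"
  assumes "\<And>x. (F has_vector_derivative f x) (at x)" "continuous_on UNIV f" "integrable lborel f"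
    and "(F \<longlongrightarrow> 0) at_top" "(F \<longlongrightarrow> 0) at_bot"
  shows "(\<integral>x. f x \<partial>lborel) = 0"
proof -
  have "(LBINT x=-\<infinity>..\<infinity>. f x) = 0 - 0"
    using assms
    by (intro interval_integral_FTC_integrable[where F = F])
       (auto simp: set_integrable_def continuous_on_eq_continuous_at ereal_tendsto_simps)
  then show ?thesis
    by (simp add: interval_lebesgue_integral_def set_lebesgue_integral_def)
qed

lemma fourier_vderiv:
  assumes f: "f \<in> schwartz"
  shows "fourier (\<lambda>x. vector_derivative f (at x)) \<omega> = \<i> * of_real \<omega> * fourier f \<omega>"
proof -
  let ?e = "\<lambda>x. exp (- (\<i> * complex_of_real x * complex_of_real \<omega>))"
  let ?f' = "\<lambda>x. vector_derivative f (at x)"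
  have f': "?f' \<in> schwartz" by (rule schwartz_vderiv[OF f])
  note int = integrable_mult_fourier_kernel[OF schwartz_integrable[OF f], of \<omega>]
    integrable_mult_fourier_kernel[OF schwartz_integrable[OF f'], of \<omega>]
  have "((\<lambda>x. exp (- (\<i> * of_real \<omega>) * of_real x)) has_vector_derivative
      - (\<i> * of_real \<omega>) * exp (- (\<i> * of_real \<omega>) * of_real x)) (at x)" for x
    by (rule has_vector_derivative_real_field) (auto intro!: derivative_eq_intros)
  moreover have "(\<lambda>x. exp (- (\<i> * of_real \<omega>) * of_real x)) = ?e"
    by (simp add: fun_eq_iff mult_ac)
  ultimately have e: "(?e has_vector_derivative - (\<i> * of_real \<omega>) * ?e x) (at x)" for x
    by (metis (no_types, lifting))
  have "(\<integral>x. ?f' x * ?e x - \<i> * of_real \<omega> * (f x * ?e x) \<partial>lborel) = 0"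
  proof (rule integral_vderiv_eq_0[where F = "\<lambda>x. f x * ?e x"])
    show "((\<lambda>x. f x * ?e x) has_vector_derivative ?f' x * ?e x - \<i> * of_real \<omega> * (f x * ?e x)) (at x)" for x
      by (rule has_vector_derivative_eq_rhs[OF has_vector_derivative_mult[OF
            schwartz_has_vector_derivative[OF f] e]]) (simp add: algebra_simps)
    show "continuous_on UNIV (\<lambda>x. ?f' x * ?e x - \<i> * of_real \<omega> * (f x * ?e x))"
      by (intro continuous_intros schwartz_continuous_on f f')
    show "integrable lborel (\<lambda>x. ?f' x * ?e x - \<i> * of_real \<omega> * (f x * ?e x))"
      by (intro Bochner_Integration.integrable_diff integrable_mult_right int)
    have "((\<lambda>x. f x * ?e x) \<longlongrightarrow> 0) F" if "F = at_top \<or> F = at_bot" for F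
      by (rule Lim_null_comparison[OF _ tendsto_norm_zero[OF schwartz_tendsto_0[OF f that]]])
         (simp add: norm_mult)
    then show "((\<lambda>x. f x * ?e x) \<longlongrightarrow> 0) at_top" "((\<lambda>x. f x * ?e x) \<longlongrightarrow> 0) at_bot" by auto
  qed
  moreover have "(\<integral>x. ?f' x * ?e x - \<i> * of_real \<omega> * (f x * ?e x) \<partial>lborel)
     = (\<integral>x. ?f' x * ?e x \<partial>lborel) - \<i> * of_real \<omega> * (\<integral>x. f x * ?e x \<partial>lborel)"
    by (subst Bochner_Integration.integral_diff) (use int in auto)
  ultimately show ?thesis
    by (simp add: fourier_def)
qed

lemma fourier_cmult: "fourier (\<lambda>x. c * f x) \<omega> = c * fourier f \<omega>"
  unfolding fourier_def by (simp add: mult.assoc)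

lemma fourier_lincomb:
  assumes "f \<in> schwartz" "g \<in> schwartz"
  shows "fourier (\<lambda>x. c * f x + g x) \<omega> = c * fourier f \<omega> + fourier g \<omega>"
proof -
  note int = integrable_mult_fourier_kernel[OF schwartz_integrable[OF assms(1)], of \<omega>]
    integrable_mult_fourier_kernel[OF schwartz_integrable[OF assms(2)], of \<omega>]
  show ?thesis
    unfolding fourier_def using int by (simp add: distrib_right mult.assoc Bochner_Integration.integral_add)
qed

text \<open>The image of \<open>schwartz\<close> under \<open>fourier\<close> is itself the
  coinductive family: differentiating a transform multiplies the original function by -ix, and
  multiplying a transform by its variable amounts to transforming -i times the derivative.\<close>

lemma fourier_schwartz:
  assumes f: "f \<in> schwartz"
  shows "fourier f \<in> schwartz"
proof (rule schwartz_coinduct[of _ "fourier ` schwartz"]; (elim imageE; hypsubst)?)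
  show "fourier f \<in> fourier ` schwartz" using f by blast
next
  fix h assume h: "h \<in> schwartz"
  show "bounded (range (fourier h))"
    using norm_fourier_le[of h] by (auto simp: bounded_iff)
  show "\<exists>f'\<in>fourier ` schwartz. \<forall>x. (fourier h has_vector_derivative f' x) (at x)"
    using fourier_has_vector_derivative[OF h] schwartz_mult_i_x[OF h] by blast
  have "(\<lambda>x. x *\<^sub>R fourier h x) = fourier (\<lambda>x. - \<i> * vector_derivative h (at x))"
  proof
    fix x
    have "fourier (\<lambda>x. - \<i> * vector_derivative h (at x)) x = - \<i> * (\<i> * of_real x * fourier h x)"
      by (subst fourier_cmult) (simp only: fourier_vderiv[OF h])
    then show "x *\<^sub>R fourier h x = fourier (\<lambda>x. - \<i> * vector_derivative h (at x)) x"
      by (simp add: scaleR_conv_of_real mult.assoc)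
  qed
  then show "(\<lambda>x. x *\<^sub>R fourier h x) \<in> fourier ` schwartz"
    using schwartz_cmult[OF schwartz_vderiv[OF h]] by blast
qed

section \<open>Gaussians and the multiplication formula\<close>

lemma fourier_gaussian:
  "fourier (\<lambda>x. of_real (exp (- (x\<^sup>2) / 2))) \<omega> = of_real (sqrt (2 * pi) * exp (- (\<omega>\<^sup>2) / 2))"
proof -
  \<comment> \<open>The characteristic function integrates against exp (itx), the opposite sign
    convention to \<open>fourier\<close>; hence the argument \<open>- \<omega>\<close>. The density
    carries the factor 1 / sqrt (2 \<pi>), which moves to the other side at the end.\<close>
  have "of_real (exp (- (\<omega>\<^sup>2) / 2)) = char std_normal_distribution (- \<omega>)"
    by (simp add: char_std_normal_distribution)
  also have "\<dots> = (\<integral>x. std_normal_density x *\<^sub>R iexp (- \<omega> * x) \<partial>lborel)"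
    unfolding char_def by (subst integral_density) (auto simp: )
  also have "\<dots> = (\<integral>x. of_real (1 / sqrt (2 * pi)) *
      (of_real (exp (- (x\<^sup>2) / 2)) * exp (- (\<i> * of_real x * of_real \<omega>))) \<partial>lborel)"
    by (intro Bochner_Integration.integral_cong refl)
       (simp add: normal_density_def scaleR_conv_of_real mult_ac)
  also have "\<dots> = of_real (1 / sqrt (2 * pi)) * fourier (\<lambda>x. of_real (exp (- (x\<^sup>2) / 2))) \<omega>"
    by (simp only: integral_mult_right_zero fourier_def)
  finally show ?thesis by (simp add: field_simps)
qed

lemma integrable_gaussian: "integrable lborel (\<lambda>x. exp (- (x\<^sup>2) / 2) :: real)"
proof -
  have "integrable lborel (\<lambda>x. sqrt (2 * pi) * std_normal_density x)"
    by (intro integrable_mult_right) simp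
  then show ?thesis by (simp add: normal_density_def)
qed

lemma integral_gaussian: "(\<integral>x. exp (- (x\<^sup>2) / 2) \<partial>lborel) = sqrt (2 * pi)"
proof -
  have "(\<integral>x. sqrt (2 * pi) * std_normal_density x \<partial>lborel) = sqrt (2 * pi)"
    by (subst integral_mult_right_zero) simp
  then show ?thesis by (simp add: normal_density_def)
qed

text \<open>Fubini. The kernel has modulus 1, so the double integral of the absolute values is the
  product of the two L1 norms; it is symmetric in its two variables, so the inner integrals are
  transforms on either side.\<close>

lemma fourier_multiplication:
  fixes f g :: "real \<Rightarrow> complex"
  assumes f: "integrable lborel f" and g: "integrable lborel g"
  shows "(\<integral>\<omega>. fourier f \<omega> * g \<omega> \<partial>lborel) = (\<integral>x. f x * fourier g x \<partial>lborel)"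
proof -
  let ?e = "\<lambda>x \<omega>. exp (- (\<i> * complex_of_real x * complex_of_real \<omega>))"
  have [measurable]: "f \<in> borel_measurable borel" "g \<in> borel_measurable borel"
    using f g by (auto dest: borel_measurable_integrable)
  have [measurable]: "(\<lambda>p. ?e (fst p) (snd p)) \<in> borel_measurable borel"
    by (intro borel_measurable_continuous_onI continuous_intros)
  have "(\<lambda>p. ?e (fst p) (snd p)) \<in> borel_measurable (borel \<Otimes>\<^sub>M borel)"
    unfolding borel_prod by measurable
  then have [measurable]: "(\<lambda>(x, y). ?e x y) \<in> borel_measurable (lborel \<Otimes>\<^sub>M lborel)"
    by (simp add: case_prod_beta' cong: measurable_cong_sets)
  have I: "integrable (lborel \<Otimes>\<^sub>M lborel) (\<lambda>(x, \<omega>). f x * ?e x \<omega> * g \<omega>)"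
  proof (rule lborel_pair.Fubini_integrable)
    show "integrable lborel (\<lambda>x. \<integral>\<omega>. norm (case (x, \<omega>) of (x, \<omega>) \<Rightarrow> f x * ?e x \<omega> * g \<omega>) \<partial>lborel)"
      using f g by (simp add: norm_mult)
    have "integrable lborel (\<lambda>\<omega>. f x * ?e x \<omega> * g \<omega>)" for x
      using integrable_mult_right[OF integrable_mult_fourier_kernel[OF g, of x], of "f x"]
      by (simp add: mult_ac)
    then show "AE x in lborel. integrable lborel (\<lambda>\<omega>. case (x, \<omega>) of (x, \<omega>) \<Rightarrow> f x * ?e x \<omega> * g \<omega>)"
      by simp
  qed measurable
  have "(\<integral>\<omega>. fourier f \<omega> * g \<omega> \<partial>lborel) = (\<integral>\<omega>. (\<integral>x. f x * ?e x \<omega> * g \<omega> \<partial>lborel) \<partial>lborel)"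
    by (simp add: fourier_def)
  also have "\<dots> = (\<integral>x. (\<integral>\<omega>. f x * ?e x \<omega> * g \<omega> \<partial>lborel) \<partial>lborel)"
    by (rule lborel_pair.Fubini_integral[OF I])
  also have "\<dots> = (\<integral>x. (\<integral>\<omega>. f x * (g \<omega> * ?e \<omega> x) \<partial>lborel) \<partial>lborel)"
    by (simp add: mult_ac)
  finally show ?thesis
    by (simp add: fourier_def)
qed

text \<open>The multiplication formula against Gaussians of growing width recovers the value at \<open>0\<close>.\<close>

lemma integral_fourier:
  assumes f: "f \<in> schwartz"
  shows "(\<integral>\<omega>. fourier f \<omega> \<partial>lborel) = of_real (2 * pi) * f 0"
proof -
  define g where "g = (\<lambda>x. complex_of_real (exp (- (x\<^sup>2) / 2)))"
  define s where "s = (\<lambda>n. inverse (real (Suc n)))"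
  have s: "s n > 0" for n by (simp add: s_def)
  have s0: "s \<longlonglongrightarrow> 0" unfolding s_def by (rule LIMSEQ_inverse_real_of_nat)
  have g_int: "integrable lborel g"
    unfolding g_def using integrable_gaussian by (rule integrable_of_real)
  have [measurable]: "g \<in> borel_measurable borel"
    using borel_measurable_integrable[OF g_int] by simp
  have [measurable]: "f \<in> borel_measurable borel" "fourier f \<in> borel_measurable borel"
    using f fourier_schwartz[OF f] by (auto intro: schwartz_measurable)
  have g_le: "norm (g x) \<le> 1" for x by (simp add: g_def)
  have Fg: "fourier g \<omega> = of_real (sqrt (2 * pi)) * g \<omega>" for \<omega>
    unfolding g_def by (subst fourier_gaussian) simp
  have g0: "g 0 = 1" by (simp add: g_def)
  have isc: "isCont g 0" unfolding g_def by (intro continuous_intros) simp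
  have scaled: "fourier (\<lambda>\<omega>. g (r * \<omega>)) x = of_real (inverse r) * fourier g (x / r)" if r: "r > 0" for r x
  proof -
    have "fourier g (x / r) = of_real r * (\<integral>\<omega>. g (0 + r * \<omega>) *
        exp (- (\<i> * of_real (0 + r * \<omega>) * of_real (x / r))) \<partial>lborel)"
      unfolding fourier_def using r
      by (subst lborel_integral_real_affine[of r _ 0]) (auto simp: scaleR_conv_of_real)
    also have "(\<integral>\<omega>. g (0 + r * \<omega>) * exp (- (\<i> * of_real (0 + r * \<omega>) * of_real (x / r))) \<partial>lborel)
      = fourier (\<lambda>\<omega>. g (r * \<omega>)) x"
      unfolding fourier_def using r by (intro Bochner_Integration.integral_cong refl) (simp add: mult.assoc)
    finally show ?thesis using r by (simp add: field_simps)
  qed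
  \<comment> \<open>The substitution \<open>x = s n * u\<close> moves the shrinking scale from the
    Gaussian to \<open>f\<close>; its Jacobian cancels the factor produced by \<open>scaled\<close>.
    Both sides now have a limit as \<open>s n\<close> tends to 0.\<close>
  have eq: "(\<integral>\<omega>. fourier f \<omega> * g (s n * \<omega>) \<partial>lborel) = (\<integral>u. f (s n * u) * fourier g u \<partial>lborel)" for n
  proof -
    have "integrable lborel (\<lambda>\<omega>. g (0 + s n * \<omega>))"
      using s[of n] by (intro lborel_integrable_real_affine g_int) simp
    then have "(\<integral>\<omega>. fourier f \<omega> * g (s n * \<omega>) \<partial>lborel)
        = (\<integral>x. f x * fourier (\<lambda>\<omega>. g (s n * \<omega>)) x \<partial>lborel)"
      by (intro fourier_multiplication schwartz_integrable[OF f]) simp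
    also have "\<dots> = s n *\<^sub>R (\<integral>x. f (0 + s n * x) * fourier (\<lambda>\<omega>. g (s n * \<omega>)) (0 + s n * x) \<partial>lborel)"
      using s[of n] by (subst lborel_integral_real_affine[of "s n" _ 0]) auto
    also have "\<dots> = (\<integral>x. s n *\<^sub>R (f (s n * x) * fourier (\<lambda>\<omega>. g (s n * \<omega>)) (s n * x)) \<partial>lborel)"
      by simp
    also have "\<dots> = (\<integral>u. f (s n * u) * fourier g u \<partial>lborel)"
      using s[of n] by (intro Bochner_Integration.integral_cong refl) (simp add: scaled scaleR_conv_of_real)
    finally show ?thesis .
  qed
  have "(\<lambda>n. \<integral>\<omega>. fourier f \<omega> * g (s n * \<omega>) \<partial>lborel) \<longlonglongrightarrow> (\<integral>\<omega>. fourier f \<omega> * g 0 \<partial>lborel)"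
  proof (rule integral_dominated_convergence[where w = "\<lambda>\<omega>. norm (fourier f \<omega>)"])
    show "AE \<omega> in lborel. (\<lambda>n. fourier f \<omega> * g (s n * \<omega>)) \<longlonglongrightarrow> fourier f \<omega> * g 0"
    proof (intro AE_I2 tendsto_intros)
      fix \<omega>
      have "(\<lambda>n. s n * \<omega>) \<longlonglongrightarrow> 0 * \<omega>" by (intro tendsto_intros s0)
      then show "(\<lambda>n. g (s n * \<omega>)) \<longlonglongrightarrow> g 0" by (intro isCont_tendsto_compose[OF isc]) simp
    qed
    show "AE \<omega> in lborel. norm (fourier f \<omega> * g (s n * \<omega>)) \<le> norm (fourier f \<omega>)" for n
      using g_le by (auto simp: norm_mult intro!: mult_left_le)
    show "integrable lborel (\<lambda>\<omega>. norm (fourier f \<omega>))"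
      by (intro integrable_norm schwartz_integrable fourier_schwartz f)
  qed measurable
  \<comment> \<open>The supremum norm of \<open>f\<close> times the transformed Gaussian dominates.
    The limit contains sqrt (2 \<pi>) twice, once from transforming the Gaussian and once from
    integrating it; together they give the constant 2 \<pi>.\<close>
  moreover have "(\<lambda>n. \<integral>u. f (s n * u) * fourier g u \<partial>lborel) \<longlonglongrightarrow> (\<integral>u. f 0 * fourier g u \<partial>lborel)"
  proof (rule integral_dominated_convergence[where w = "\<lambda>u. schwartz_seminorm 0 0 f * norm (fourier g u)"])
    show "AE u in lborel. (\<lambda>n. f (s n * u) * fourier g u) \<longlonglongrightarrow> f 0 * fourier g u"
    proof (intro AE_I2 tendsto_intros)
      fix u
      have "(\<lambda>n. s n * u) \<longlonglongrightarrow> 0 * u" by (intro tendsto_intros s0)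
      then show "(\<lambda>n. f (s n * u)) \<longlonglongrightarrow> f 0"
        using schwartz_continuous_on[OF f, of UNIV]
        by (intro isCont_tendsto_compose[of _ f]) (auto simp: continuous_on_eq_continuous_at)
    qed
    show "AE u in lborel. norm (f (s n * u) * fourier g u) \<le> schwartz_seminorm 0 0 f * norm (fourier g u)" for n
      using schwartz_norm_le[OF f] by (auto simp: norm_mult intro!: mult_right_mono)
    show "integrable lborel (\<lambda>u. schwartz_seminorm 0 0 f * norm (fourier g u))"
      unfolding Fg by (intro integrable_mult_right integrable_norm g_int)
  qed (simp_all add: Fg[abs_def])
  ultimately have "(\<integral>\<omega>. fourier f \<omega> * g 0 \<partial>lborel) = (\<integral>u. f 0 * fourier g u \<partial>lborel)"
    unfolding eq by (rule LIMSEQ_unique)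
  then have "(\<integral>\<omega>. fourier f \<omega> \<partial>lborel) = f 0 * (of_real (sqrt (2 * pi)) * (\<integral>u. g u \<partial>lborel))"
    by (simp add: Fg g0)
  also have "(\<integral>u. g u \<partial>lborel) = of_real (sqrt (2 * pi))"
    unfolding g_def using integral_gaussian by simp
  also have "f 0 * (of_real (sqrt (2 * pi)) * of_real (sqrt (2 * pi))) = of_real (2 * pi) * f 0"
    by (simp add: mult_ac flip: of_real_mult)
  finally show ?thesis .
qed

section \<open>Fourier inversion and injectivity on distributions\<close>

lemma schwartz_translate:
  assumes "f \<in> schwartz"
  shows "(\<lambda>x. f (x + a)) \<in> schwartz"
proof (rule schwartz_coinduct[of _ "{\<lambda>x. h (x + a) | h. h \<in> schwartz}"];
    (elim CollectE exE conjE)?; simp?)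
  show "\<exists>h. (\<lambda>x. f (x + a)) = (\<lambda>x. h (x + a)) \<and> h \<in> schwartz"
    using assms by blast
next
  fix h assume h: "h \<in> schwartz"
  show "bounded (range (\<lambda>x. h (x + a)))"
    using schwartz_bounded_pow[OF h, of 0] by (auto simp: bounded_iff)
  have "((\<lambda>x. h (x + a)) has_vector_derivative vector_derivative h (at (x + a))) (at x)" for x
    using vector_diff_chain_at[OF has_vector_derivative_add[OF has_vector_derivative_id
        has_vector_derivative_const] schwartz_has_vector_derivative[OF h]]
    by (simp add: comp_def)
  then show "\<exists>f'. (\<exists>h. f' = (\<lambda>x. h (x + a)) \<and> h \<in> schwartz) \<and>
     (\<forall>x. ((\<lambda>x. h (x + a)) has_vector_derivative f' x) (at x))"
    using schwartz_vderiv[OF h]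
    by (intro exI[of _ "\<lambda>x. vector_derivative h (at (x + a))"] conjI allI
         exI[of _ "\<lambda>x. vector_derivative h (at x)"]) auto
  show "\<exists>h'. (\<lambda>x. x *\<^sub>R h (x + a)) = (\<lambda>x. h' (x + a)) \<and> h' \<in> schwartz"
    by (rule exI[of _ "\<lambda>x. - a * h x + x *\<^sub>R h x"])
       (use schwartz_lincomb[OF h schwartz_mult_x[OF h], of "- a"] in \<open>simp add: scaleR_conv_of_real algebra_simps\<close>)
qed

lemma fourier_translate:
  "fourier (\<lambda>x. f (x + a)) \<omega> = fourier f \<omega> * exp (\<i> * of_real \<omega> * of_real a)"
proof -
  have "fourier f \<omega> * exp (\<i> * of_real \<omega> * of_real a) = (\<integral>x. f (a + 1 * x) *
     exp (- (\<i> * of_real (a + 1 * x) * of_real \<omega>)) \<partial>lborel) * exp (\<i> * of_real \<omega> * of_real a)"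
    unfolding fourier_def by (subst lborel_integral_real_affine[of 1 _ a]) auto
  also have "\<dots> = (\<integral>x. f (a + 1 * x) *
     exp (- (\<i> * of_real (a + 1 * x) * of_real \<omega>)) * exp (\<i> * of_real \<omega> * of_real a) \<partial>lborel)"
    by simp
  also have "\<dots> = fourier (\<lambda>x. f (x + a)) \<omega>"
    unfolding fourier_def
    by (intro Bochner_Integration.integral_cong refl)
       (simp add: mult_exp_exp mult.assoc algebra_simps)
  finally show ?thesis ..
qed

text \<open>Inversion at an arbitrary point is inversion at 0 for a translate: the kernel of the
  outer transform is exactly the factor that translation by \<open>- x\<close> produces in the inner
  one.\<close>

lemma fourier_fourier:
  assumes f: "f \<in> schwartz"
  shows "fourier (fourier f) x = of_real (2 * pi) * f (- x)"
proof -
  have "fourier (fourier f) x = (\<integral>\<omega>. fourier (\<lambda>y. f (y + - x)) \<omega> \<partial>lborel)"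
    unfolding fourier_translate by (simp add: fourier_def[of "fourier f"] mult_ac)
  also have "\<dots> = of_real (2 * pi) * f (- x)"
    by (subst integral_fourier[OF schwartz_translate[OF f]]) simp
  finally show ?thesis .
qed

definition inv_fourier :: "(real \<Rightarrow> complex) \<Rightarrow> real \<Rightarrow> complex" where
  "inv_fourier f x = fourier f (- x) / (2 * pi)"

lemma inv_fourier_schwartz: "f \<in> schwartz \<Longrightarrow> inv_fourier f \<in> schwartz"
  using schwartz_cmult[OF schwartz_reflect[OF fourier_schwartz], of f "1 / (2 * pi)"]
  by (simp add: inv_fourier_def[abs_def])

lemma inv_fourier_fourier: "f \<in> schwartz \<Longrightarrow> inv_fourier (fourier f) = f"
  by (rule ext) (simp add: inv_fourier_def fourier_fourier)

lemma fourier_reflect: "fourier (\<lambda>x. f (- x)) \<omega> = fourier f (- \<omega>)"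
  unfolding fourier_def by (subst lborel_integral_real_affine[of "- 1" _ 0]) auto

lemma fourier_inv_fourier:
  assumes "f \<in> schwartz"
  shows "fourier (inv_fourier f) = f"
proof
  fix x
  have "fourier (inv_fourier f) x = fourier (\<lambda>x. 1 / (2 * pi) * fourier f (- x)) x"
    by (simp add: inv_fourier_def[abs_def])
  then show "fourier (inv_fourier f) x = f x"
    unfolding fourier_cmult fourier_reflect by (simp add: fourier_fourier[OF assms])
qed

lemma inv_fourier_lincomb:
  "f \<in> schwartz \<Longrightarrow> g \<in> schwartz \<Longrightarrow>
    inv_fourier (\<lambda>x. c * f x + g x) x = c * inv_fourier f x + inv_fourier g x"
  by (simp add: inv_fourier_def fourier_lincomb add_divide_distrib)

text \<open>Every Schwartz function is a transform, namely that of its \<open>inv_fourier\<close>,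
  so testing the equation there recovers the value of both functionals. Off the Schwartz space both
  are 0. This is the uniqueness half of the definite descriptions.\<close>

lemma fourier_distr_inject:
  assumes "tempered S" "tempered T" and eq: "fourier_distr S = fourier_distr T"
  shows "S = T"
proof
  have "on_schwartz S = S" "on_schwartz T = T"
    by (rule assms(1,2)[unfolded tempered_def, THEN conjunct1])+
  note outside = this[THEN fun_cong]
  fix f
  show "S f = T f"
  proof (cases "f \<in> schwartz")
    case True
    then show ?thesis
      using fun_cong[OF eq, of "inv_fourier f"]
      by (simp add: fourier_distr_def on_schwartz_def inv_fourier_schwartz fourier_inv_fourier)
  next
    case False
    then show ?thesis
      using outside[of f] by (simp add: on_schwartz_def)
  qed
qed

text \<open>Two derivatives of \<open>f\<close> buy a factor \<open>\<omega>\<^sup>2\<close>. The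
  four seminorms are those of the L1 bounds for \<open>f\<close> and for its second derivative. The
  estimate makes pairings with \<open>inv_fourier\<close> continuous.\<close>

lemma fourier_decay:
  assumes f: "f \<in> schwartz"
  shows "norm (fourier f \<omega>) \<le> pi * (schwartz_seminorm 0 0 f + schwartz_seminorm 2 0 f
    + schwartz_seminorm 0 2 f + schwartz_seminorm 2 2 f) * inverse (1 + \<omega>\<^sup>2)"
proof -
  let ?f1 = "\<lambda>x. vector_derivative f (at x)"
  let ?f2 = "\<lambda>x. vector_derivative ?f1 (at x)"
  have f1: "?f1 \<in> schwartz" and f2: "?f2 \<in> schwartz"
    using f by (auto intro: schwartz_vderiv)
  have n2: "nth_vderiv k ?f2 = nth_vderiv (k + 2) f" for k
    by (simp add: nth_vderiv_Suc_shift)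
  have sem: "schwartz_seminorm m 0 ?f2 = schwartz_seminorm m 2 f" for m
    unfolding schwartz_seminorm_def using n2[of 0] by (simp add: numeral_2_eq_2)
  have "fourier ?f2 \<omega> = \<i> * of_real \<omega> * (\<i> * of_real \<omega> * fourier f \<omega>)"
    by (simp only: fourier_vderiv[OF f1] fourier_vderiv[OF f])
  then have "\<omega>\<^sup>2 * norm (fourier f \<omega>) = norm (fourier ?f2 \<omega>)"
    by (simp add: norm_mult power2_eq_square abs_mult_self_eq flip: mult.assoc)
  also have "\<dots> \<le> pi * (schwartz_seminorm 0 2 f + schwartz_seminorm 2 2 f)"
    using order_trans[OF norm_fourier_le schwartz_L1_le[OF f2]] by (simp add: sem)
  finally have "(1 + \<omega>\<^sup>2) * norm (fourier f \<omega>) \<le> pi * (schwartz_seminorm 0 0 f + schwartz_seminorm 2 0 f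
    + schwartz_seminorm 0 2 f + schwartz_seminorm 2 2 f)"
    using order_trans[OF norm_fourier_le[of f \<omega>] schwartz_L1_le[OF f]] by (simp add: algebra_simps)
  then show ?thesis
    by (simp add: field_simps add_pos_nonneg)
qed

section \<open>Functions of polynomial growth are determined by their distributions\<close>

lemma poly_abs_growth: "\<exists>C N. \<forall>x::real. \<bar>poly Q x\<bar> \<le> C * (1 + \<bar>x\<bar>) ^ N"
proof (induction Q)
  case 0
  show ?case by (intro exI[of _ 0]) simp
next
  case (pCons a Q)
  then obtain C N where CN: "\<And>x. \<bar>poly Q x\<bar> \<le> C * (1 + \<bar>x\<bar>) ^ N" by blast
  have "\<bar>poly (pCons a Q) x\<bar> \<le> (\<bar>a\<bar> + C) * (1 + \<bar>x\<bar>) ^ Suc N" for x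
  proof -
    have C: "0 \<le> C * (1 + \<bar>x\<bar>) ^ N" using CN[of x] by linarith
    have "\<bar>poly (pCons a Q) x\<bar> \<le> \<bar>a\<bar> + \<bar>x\<bar> * \<bar>poly Q x\<bar>"
      by (simp add: abs_mult abs_triangle_ineq[THEN order_trans])
    also have "\<dots> \<le> \<bar>a\<bar> * 1 + (1 + \<bar>x\<bar>) * (C * (1 + \<bar>x\<bar>) ^ N)"
      using CN[of x] C by (simp add: distrib_right) (meson abs_ge_zero add_increasing mult_left_mono)
    also have "\<dots> \<le> \<bar>a\<bar> * (1 + \<bar>x\<bar>) ^ Suc N + (1 + \<bar>x\<bar>) * (C * (1 + \<bar>x\<bar>) ^ N)"
      by (intro add_right_mono mult_left_mono one_le_power) auto
    finally show ?thesis by (simp add: algebra_simps)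
  qed
  then show ?case by blast
qed

text \<open>One term of the exponential series is at most the whole sum.\<close>

lemma power_le_fact_exp: "0 \<le> y \<Longrightarrow> y ^ n \<le> fact n * exp (y::real)"
  using exp_converges[of y] sum_le_suminf[of "\<lambda>n. y ^ n /\<^sub>R fact n" "{n}"]
  by (simp add: sums_iff field_simps)

lemma growth_exp_le: "(1 + \<bar>x\<bar>) ^ n * exp (- x\<^sup>2) \<le> fact n * exp (2::real)"
proof -
  have "0 \<le> (\<bar>x\<bar> - 1)\<^sup>2 + \<bar>x\<bar>" by simp
  then have "1 + \<bar>x\<bar> + - x\<^sup>2 \<le> 2" by (simp add: power2_eq_square algebra_simps)
  have "(1 + \<bar>x\<bar>) ^ n * exp (- x\<^sup>2) \<le> fact n * exp (1 + \<bar>x\<bar>) * exp (- x\<^sup>2)"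
    by (intro mult_right_mono power_le_fact_exp) auto
  also have "\<dots> = fact n * exp (1 + \<bar>x\<bar> + - x\<^sup>2)"
    by (simp only: exp_add mult.assoc)
  also have "\<dots> \<le> fact n * exp 2"
    using \<open>1 + \<bar>x\<bar> + - x\<^sup>2 \<le> 2\<close> by simp
  finally show ?thesis .
qed

text \<open>For fixed \<open>P\<close>, letting \<open>Q\<close> range over all polynomials gives a
  family closed under differentiation and under multiplication by \<open>x\<close>; the hypothesis
  on \<open>P\<close> supplies a Gaussian majorant. These are all the test functions that the
  uniqueness argument needs, and none of them has compact support.\<close>

lemma poly_exp_schwartz:
  fixes P Q :: "real poly"
  assumes P: "\<And>x. x\<^sup>2 \<le> poly P x"
  shows "(\<lambda>x. complex_of_real (poly Q x * exp (- poly P x))) \<in> schwartz"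
proof (rule schwartz_coinduct[of _ "range (\<lambda>Q x. complex_of_real (poly Q x * exp (- poly P x)))"];
    (elim imageE; hypsubst)?)
  show "(\<lambda>x. complex_of_real (poly Q x * exp (- poly P x)))
      \<in> range (\<lambda>Q x. complex_of_real (poly Q x * exp (- poly P x)))"
    by blast
next
  fix Q :: "real poly"
  obtain C N where CN: "\<And>x. \<bar>poly Q x\<bar> \<le> C * (1 + \<bar>x\<bar>) ^ N" using poly_abs_growth by blast
  have C: "C \<ge> 0" using order_trans[OF abs_ge_zero CN[of 0]] by simp
  have "norm (complex_of_real (poly Q x * exp (- poly P x))) \<le> C * (fact N * exp 2)" for x
  proof -
    have "norm (complex_of_real (poly Q x * exp (- poly P x))) = \<bar>poly Q x\<bar> * exp (- poly P x)"
      by (simp add: norm_mult)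
    also have "\<dots> \<le> (C * (1 + \<bar>x\<bar>) ^ N) * exp (- x\<^sup>2)"
      by (rule mult_mono[OF CN]) (use P[of x] C in auto)
    also have "\<dots> \<le> C * (fact N * exp 2)"
      using mult_left_mono[OF growth_exp_le C] by (simp add: mult.assoc)
    finally show ?thesis .
  qed
  then show "bounded (range (\<lambda>x. complex_of_real (poly Q x * exp (- poly P x))))"
    by (auto simp: bounded_iff)
  have "((\<lambda>x. complex_of_real (poly Q x * exp (- poly P x))) has_vector_derivative
      complex_of_real (poly (pderiv Q - Q * pderiv P) x * exp (- poly P x))) (at x)" for x
    by (rule has_vector_derivative_of_real)
       (auto intro!: derivative_eq_intros poly_DERIV simp: algebra_simps)
  then show "\<exists>f'\<in>range (\<lambda>Q x. complex_of_real (poly Q x * exp (- poly P x))).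
     \<forall>x. ((\<lambda>x. complex_of_real (poly Q x * exp (- poly P x))) has_vector_derivative f' x) (at x)"
    by (intro bexI[of _ "\<lambda>x. complex_of_real (poly (pderiv Q - Q * pderiv P) x * exp (- poly P x))"] allI rangeI)
  have "(\<lambda>x. x *\<^sub>R complex_of_real (poly Q x * exp (- poly P x)))
      = (\<lambda>x. complex_of_real (poly (pCons 0 Q) x * exp (- poly P x)))"
    by (simp add: fun_eq_iff scaleR_conv_of_real)
  then show "(\<lambda>x. x *\<^sub>R complex_of_real (poly Q x * exp (- poly P x)))
      \<in> range (\<lambda>Q x. complex_of_real (poly Q x * exp (- poly P x)))"
    by blast
qed

lemma borel_eq_greaterThanLessThan_real: "(borel :: real measure) = sigma UNIV (range (\<lambda>(a, b). {a<..<b}))"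
  using borel_eq_box[where 'a = real] by (simp add: box_real)

text \<open>A Dynkin argument: open intervals, the empty one included, are stable under intersection
  and generate the Borel sets, so the integral vanishes on every Borel set and \<open>h\<close> is a
  density of the zero measure.\<close>

lemma AE_eq_0_if_interval_integrals:
  fixes h :: "real \<Rightarrow> complex"
  assumes h: "integrable lborel h"
    and I: "\<And>a b. a < b \<Longrightarrow> set_lebesgue_integral lborel {a<..<b} h = 0"
  shows "AE x in lborel. h x = 0"
proof (rule sigma_finite_measure.density_zero[OF lborel.sigma_finite_measure_axioms h])
  let ?G = "range (\<lambda>(a, b). {a<..<b::real})"
  have hm [measurable]: "h \<in> borel_measurable borel"
    using borel_measurable_integrable[OF h] by simp
  have si: "set_integrable lborel A h" if "A \<in> sets borel" for A
    unfolding set_integrable_def by (intro integrable_mult_indicator h) (use that in simp)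
  \<comment> \<open>Passing to complements requires the integral over the whole line, obtained as a
    limit over growing symmetric intervals.\<close>
  have U: "set_lebesgue_integral lborel UNIV h = 0"
  proof (rule LIMSEQ_unique)
    show "(\<lambda>n. set_lebesgue_integral lborel {- real (Suc n)<..<real (Suc n)} h)
        \<longlonglongrightarrow> set_lebesgue_integral lborel UNIV h"
      unfolding set_lebesgue_integral_def
    proof (rule integral_dominated_convergence[where w = "\<lambda>x. norm (h x)"])
      show "AE x in lborel. (\<lambda>n. indicat_real {- real (Suc n)<..<real (Suc n)} x *\<^sub>R h x)
         \<longlonglongrightarrow> indicat_real UNIV x *\<^sub>R h x"
      proof (rule AE_I2, rule tendsto_eventually)
        fix x
        obtain m where m: "\<bar>x\<bar> < real m" using reals_Archimedean2 by blast
        show "\<forall>\<^sub>F n in sequentially. indicat_real {- real (Suc n)<..<real (Suc n)} x *\<^sub>R h x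
            = indicat_real UNIV x *\<^sub>R h x"
          using eventually_ge_at_top[of m] by eventually_elim (use m in \<open>auto simp: indicator_def\<close>)
      qed
    qed (use h in \<open>auto simp: indicator_def\<close>)
    show "(\<lambda>n. set_lebesgue_integral lborel {- real (Suc n)<..<real (Suc n)} h) \<longlonglongrightarrow> 0"
      by (simp add: I)
  qed
  fix A :: "real set" assume "A \<in> sets lborel"
  then have A: "A \<in> sigma_sets UNIV ?G"
    by (simp add: borel_eq_greaterThanLessThan_real)
  have "{a<..<b} \<inter> {c<..<d} = {max a c<..<min b d}" for a b c d :: real by auto
  then have "Int_stable ?G" by (auto simp: Int_stable_def)
  moreover have "?G \<subseteq> Pow UNIV" by simp
  ultimately show "set_lebesgue_integral lborel A h = 0" using A
  proof (induction rule: sigma_sets_induct_disjoint)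
    case (basic A)
    then obtain a b where "A = {a<..<b}" by auto
    show ?case
    proof (cases "a < b")
      case True
      then show ?thesis unfolding \<open>A = {a<..<b}\<close> by (rule I)
    next
      case False
      then have "A = {}" using \<open>A = {a<..<b}\<close> by auto
      then show ?thesis by (simp add: set_lebesgue_integral_def)
    qed
  next
    case empty
    show ?case by (simp add: set_lebesgue_integral_def)
  next
    case (compl A)
    then have A: "A \<in> sets borel" by (simp add: borel_eq_greaterThanLessThan_real)
    have "set_lebesgue_integral lborel UNIV h = set_lebesgue_integral lborel ((UNIV - A) \<union> A) h"
      by simp
    also have "\<dots> = set_lebesgue_integral lborel (UNIV - A) h + set_lebesgue_integral lborel A h"
      by (rule set_integral_Un) (use A in \<open>auto intro!: si\<close>)
    finally show ?case using compl U by simp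
  next
    case (union A)
    then have A: "A i \<in> sets borel" for i by (auto simp: borel_eq_greaterThanLessThan_real)
    have "set_lebesgue_integral lborel (\<Union>i. A i) h = (\<Sum>i. set_lebesgue_integral lborel (A i) h)"
      by (rule lebesgue_integral_countable_add)
         (use A union in \<open>auto intro!: si simp: disjoint_family_on_def\<close>)
    then show ?case using union by simp
  qed
qed

lemma growth_times_gaussian_integrable:
  fixes g :: "real \<Rightarrow> complex"
  assumes [measurable]: "g \<in> borel_measurable borel" and g: "\<And>x. norm (g x) \<le> C * (1 + \<bar>x\<bar>) ^ N"
  shows "integrable lborel (\<lambda>x. of_real (exp (- x\<^sup>2)) * g x)"
proof (rule Bochner_Integration.integrable_bound[OF
      integrable_mult_right[OF integrable_inverse_1_plus_square_lborel]])
  have C: "C \<ge> 0" using order_trans[OF norm_ge_zero g[of 0]] by simp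
  show "AE x in lborel. norm (of_real (exp (- x\<^sup>2)) * g x)
      \<le> norm (C * (fact (N + 2) * exp 2) * inverse (1 + x\<^sup>2))"
  proof (rule AE_I2)
    fix x :: real
    have "(1 + x\<^sup>2) * norm (of_real (exp (- x\<^sup>2)) * g x) = (1 + x\<^sup>2) * (exp (- x\<^sup>2) * norm (g x))"
      by (simp add: norm_mult)
    \<comment> \<open>The integrable weight costs two more powers of
      \<open>1 + \<bar>x\<bar>\<close>, which explains the exponent \<open>N + 2\<close>.\<close>
    also have "\<dots> \<le> (1 + \<bar>x\<bar>)\<^sup>2 * (exp (- x\<^sup>2) * (C * (1 + \<bar>x\<bar>) ^ N))"
      using g[of x] by (intro mult_mono) (auto simp: power2_eq_square algebra_simps)
    also have "\<dots> = C * ((1 + \<bar>x\<bar>) ^ (N + 2) * exp (- x\<^sup>2))"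
      by (simp add: power_add power2_eq_square mult_ac)
    also have "\<dots> \<le> C * (fact (N + 2) * exp 2)"
      by (intro mult_left_mono growth_exp_le C)
    finally have "norm (of_real (exp (- x\<^sup>2)) * g x) \<le> C * (fact (N + 2) * exp 2) * inverse (1 + x\<^sup>2)"
      by (simp add: field_simps add_pos_nonneg)
    then show "norm (of_real (exp (- x\<^sup>2)) * g x) \<le> norm (C * (fact (N + 2) * exp 2) * inverse (1 + x\<^sup>2))"
      by (rule order_trans) simp
  qed
qed measurable

text \<open>The Schwartz functions \<open>exp (- x\<^sup>2 - ((x - c) / r) ^ (2 * m))\<close> tend to the indicator function of
  \<open>{c - r<..<c + r}\<close> times a Gaussian.\<close>

lemma AE_eq_0_if_schwartz_integrals:
  fixes g :: "real \<Rightarrow> complex"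
  assumes [measurable]: "g \<in> borel_measurable borel" and g: "\<And>x. norm (g x) \<le> C * (1 + \<bar>x\<bar>) ^ N"
    and I: "\<And>\<phi>. \<phi> \<in> schwartz \<Longrightarrow> (\<integral>x. \<phi> x * g x \<partial>lborel) = 0"
  shows "AE x in lborel. g x = 0"
proof -
  \<comment> \<open>A function of polynomial growth may fail to be integrable. The Gaussian factor
    repairs this and, being nowhere zero, preserves the zeros.\<close>
  define h where "h = (\<lambda>x. of_real (exp (- x\<^sup>2)) * g x)"
  have h: "integrable lborel h"
    unfolding h_def by (rule growth_times_gaussian_integrable) (use g in auto)
  have [measurable]: "h \<in> borel_measurable borel" unfolding h_def by measurable
  have "AE x in lborel. h x = 0"
  proof (rule AE_eq_0_if_interval_integrals[OF h])
    fix a b :: real assume ab: "a < b"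
    define c r where "c = (a + b) / 2" and "r = (b - a) / 2"
    have r: "r > 0" using ab by (simp add: r_def)
    define u where "u = (\<lambda>m x. exp (- (((x - c) / r)\<^sup>2 ^ m)))"
    have [measurable]: "u m \<in> borel_measurable borel" for m unfolding u_def by measurable
    have z: "(\<integral>x. u m x *\<^sub>R h x \<partial>lborel) = 0" for m
    proof -
      \<comment> \<open>The Gaussian inside \<open>h\<close> is absorbed into the exponent, so that
        \<open>g\<close> itself is tested against a Schwartz function. The second summand is a power
        of a square, so it is nonnegative and \<open>P\<close> dominates
        \<open>x\<^sup>2\<close>.\<close>
      define P where "P = [:0, 0, 1:] + ([:- c / r, 1 / r:] ^ 2) ^ m"
      have P: "poly P x = x\<^sup>2 + ((x - c) / r)\<^sup>2 ^ m" for x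
        using r by (simp add: P_def power2_eq_square field_simps)
      have "(\<lambda>x. complex_of_real (poly 1 x * exp (- poly P x))) \<in> schwartz"
        by (rule poly_exp_schwartz) (simp add: P)
      from I[OF this] show ?thesis
        by (simp add: P h_def u_def exp_add exp_minus exp_diff scaleR_conv_of_real divide_inverse mult_ac)
    qed
    have "(\<lambda>m. \<integral>x. u m x *\<^sub>R h x \<partial>lborel) \<longlonglongrightarrow> (\<integral>x. indicat_real {a<..<b} x *\<^sub>R h x \<partial>lborel)"
    proof (rule integral_dominated_convergence[where w = "\<lambda>x. norm (h x)"])
      show "AE x in lborel. (\<lambda>m. u m x *\<^sub>R h x) \<longlonglongrightarrow> indicat_real {a<..<b} x *\<^sub>R h x"
        \<comment> \<open>At the two endpoints \<open>u m x\<close> is constantly exp (-1), which is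
          not a value of the indicator, so they are discarded as a null set.\<close>
        using AE_lborel_singleton[of a] AE_lborel_singleton[of b]
      proof eventually_elim
        fix x assume x: "x \<noteq> a" "x \<noteq> b"
        define t where "t = ((x - c) / r)\<^sup>2"
        have t0: "t \<ge> 0" by (simp add: t_def)
        have abs1: "t < 1 \<longleftrightarrow> \<bar>x - c\<bar> < r" "t = 1 \<longleftrightarrow> \<bar>x - c\<bar> = r"
          using r by (auto simp: t_def abs_square_less_1 abs_square_eq_1)
        have "(\<lambda>m. exp (- (t ^ m))) \<longlonglongrightarrow> indicat_real {a<..<b} x"
        proof (cases "t < 1")
          case True
          then have "(\<lambda>m. exp (- (t ^ m))) \<longlonglongrightarrow> exp (- 0)"
            by (intro tendsto_intros LIMSEQ_realpow_zero t0)
          moreover have "x \<in> {a<..<b}" using True abs1 by (simp add: c_def r_def abs_less_iff) argo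
          ultimately show ?thesis by simp
        next
          case False
          have "t \<noteq> 1" using x unfolding abs1 by (auto simp: c_def r_def abs_if field_simps)
          with False have "t > 1" by simp
          then have "filterlim (\<lambda>m. t ^ m) at_top sequentially"
            by (intro filterlim_at_infinity_imp_filterlim_at_top[OF filterlim_realpow_sequentially_gt1]) auto
          then have "(\<lambda>m. exp (- (t ^ m))) \<longlonglongrightarrow> 0"
            by (intro filterlim_compose[OF exp_at_bot]) (simp add: filterlim_uminus_at_bot)
          moreover have "x \<notin> {a<..<b}" using False abs1 by (auto simp: c_def r_def abs_if field_simps split: if_splits)
          ultimately show ?thesis by simp
        qed
        then show "(\<lambda>m. u m x *\<^sub>R h x) \<longlonglongrightarrow> indicat_real {a<..<b} x *\<^sub>R h x"
          unfolding u_def t_def by (intro tendsto_intros)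
      qed
      show "AE x in lborel. norm (u m x *\<^sub>R h x) \<le> norm (h x)" for m
        by (auto simp: u_def intro!: mult_left_le_one_le)
    qed (use h in auto)
    then show "set_lebesgue_integral lborel {a<..<b} h = 0"
      unfolding z set_lebesgue_integral_def by (simp add: LIMSEQ_const_iff)
  qed
  then show ?thesis by (auto simp: h_def)
qed

section \<open>The binomial series on the boundary of the disc\<close>

text \<open>In the asymptotics of the generalized binomial coefficient the quotient
  \<open>?X\<close> converges, hence is bounded. This bounds \<open>norm (a gchoose n)\<close> by a
  multiple of n^(- Re a - 1), whose exponent is below -1.\<close>

lemma summable_norm_gbinomial:
  fixes a :: complex
  assumes a: "Re a > 0"
  shows "summable (\<lambda>k. norm (a gchoose k))"
proof -
  let ?X = "\<lambda>n. (a gchoose n) / ((-1)^n / exp ((a+1) * of_real (ln (real n))))"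
  have "Bseq ?X"
    using gbinomial_asymptotic[of a] by (rule convergentI[THEN convergent_imp_Bseq])
  then obtain K where K: "\<And>n. norm (?X n) \<le> K" by (auto simp: Bseq_def)
  have "norm (a gchoose n) \<le> K * norm (exp (of_real (ln (of_nat n)) * (- (a + 1))))" for n
  proof -
    have "(a gchoose n) = ?X n * (-1) ^ n * exp (of_real (ln (of_nat n)) * (- (a + 1)))"
      unfolding mult_minus_right exp_minus by (simp add: mult.commute)
    then have "norm (a gchoose n)
        = norm (?X n * (-1) ^ n * exp (of_real (ln (of_nat n)) * (- (a + 1))))"
      by (rule arg_cong)
    also have "\<dots> = norm (?X n) * norm (exp (of_real (ln (of_nat n)) * (- (a + 1))))"
      by (simp only: norm_mult norm_power norm_minus_cancel norm_one power_one mult_1_right)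
    also have "\<dots> \<le> K * norm (exp (of_real (ln (of_nat n)) * (- (a + 1))))"
      by (intro mult_right_mono K) simp
    finally show ?thesis .
  qed
  then have le: "norm (norm (a gchoose n)) \<le> K * norm (exp (of_real (ln (of_nat n)) * (- (a + 1))))" for n
    by simp
  have "summable (\<lambda>n. K * norm (exp (of_real (ln (of_nat n)) * (- (a + 1)))))"
    by (rule summable_mult, rule iffD2[OF abs_summable_complex_powr_iff]) (use a in simp)
  then show ?thesis
    by (rule summable_comparison_test'[where N = 0]) (rule le)
qed

text \<open>Abel's limit argument. Absolute summability of the coefficients makes the series
  uniformly convergent, hence continuous, on the closed disc, and \<open>z\<close> is approached
  along its radius, where the binomial theorem is known. For \<open>z \<noteq> - 1\<close> the
  number \<open>1 + z\<close> has positive real part, so the principal power is continuous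
  there.\<close>

lemma gen_binomial_complex_circle:
  fixes a z :: complex
  assumes a: "Re a > 0" and z: "norm z \<le> 1" "z \<noteq> - 1"
  shows "(\<lambda>k. (a gchoose k) * z ^ k) sums (1 + z) powr a"
proof -
  let ?f = "\<lambda>w. \<Sum>k. (a gchoose k) * w ^ k"
  have le: "norm ((a gchoose k) * w ^ k) \<le> norm (a gchoose k)" if "norm w \<le> 1" for k and w :: complex
    using that by (simp add: norm_mult norm_power mult_left_le power_le_one)
  have "uniform_limit (cball 0 1) (\<lambda>n w. \<Sum>k<n. (a gchoose k) * w ^ k) ?f sequentially"
    by (rule Weierstrass_m_test[OF _ summable_norm_gbinomial[OF a]]) (use le in simp)
  then have cont: "continuous_on (cball 0 1) ?f"
    by (rule uniform_limit_theorem[rotated]) (auto intro!: always_eventually continuous_intros)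
  define r where "r = (\<lambda>n. 1 - inverse (real (Suc n)))"
  have "r \<longlonglongrightarrow> 1 - 0" unfolding r_def by (intro tendsto_intros LIMSEQ_inverse_real_of_nat)
  then have "(\<lambda>n. of_real (r n) * z) \<longlonglongrightarrow> of_real 1 * z" by (intro tendsto_intros) simp
  then have rz: "(\<lambda>n. of_real (r n) * z) \<longlonglongrightarrow> z" by simp
  have r01: "0 \<le> r n" "r n < 1" for n by (simp_all add: r_def inverse_le_1_iff)
  have rlt: "norm (of_real (r n) * z) < 1" for n
  proof -
    have "norm (of_real (r n) * z) \<le> r n * 1"
      using z(1) r01[of n] by (simp add: norm_mult mult_left_le)
    then show ?thesis using r01[of n] by linarith
  qed
  have "(\<lambda>n. ?f (of_real (r n) * z)) \<longlonglongrightarrow> ?f z"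
    by (rule continuous_on_tendsto_compose[OF cont rz]) (use z rlt in \<open>auto intro!: always_eventually less_imp_le\<close>)
  moreover have "?f (of_real (r n) * z) = (1 + of_real (r n) * z) powr a" for n
    using gen_binomial_complex[OF rlt, of a n] by (simp add: sums_iff)
  moreover have "(\<lambda>n. (1 + of_real (r n) * z) powr a) \<longlonglongrightarrow> (1 + z) powr a"
  proof (intro tendsto_powr_complex tendsto_intros rz)
    have "\<bar>Re z\<bar> \<le> 1" using z(1) abs_Re_le_cmod[of z] by linarith
    moreover have "Re z \<noteq> - 1"
    proof
      assume *: "Re z = - 1"
      then have "(Im z)\<^sup>2 \<le> 0" using power_mono[OF z(1), of 2] by (simp add: cmod_power2)
      then show False using * z(2) by (simp add: complex_eq_iff)
    qed
    ultimately show "1 + z \<notin> \<real>\<^sub>\<le>\<^sub>0" by (auto simp: complex_nonpos_Reals_iff)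
  qed
  ultimately have "?f z = (1 + z) powr a" by (simp add: LIMSEQ_unique)
  moreover have "summable (\<lambda>k. (a gchoose k) * z ^ k)"
    by (rule summable_norm_cancel, rule summable_comparison_test'[OF summable_norm_gbinomial[OF a]])
       (use le z in simp)
  ultimately show ?thesis by (simp add: sums_iff)
qed

section \<open>The function Omega and branches of its powers\<close>

lemma exp_minus_i: "exp (- (\<i> * complex_of_real \<omega>)) = Complex (cos \<omega>) (- sin \<omega>)"
  by (simp add: complex_eq_iff Re_exp Im_exp)

lemma i_mult_Omega: "\<i> * of_real \<omega> * Omega \<omega> = 1 - exp (- (\<i> * of_real \<omega>))"
  by (simp add: Omega_def)

lemma Im_Omega: "Im (Omega \<omega>) = - (1 - cos \<omega>) / \<omega>"
proof (cases "\<omega> = 0")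
  case False
  have "Omega \<omega> = Complex (sin \<omega> / \<omega>) (- (1 - cos \<omega>) / \<omega>)"
    using False i_mult_Omega[of \<omega>] by (simp add: exp_minus_i complex_eq_iff field_simps)
  then show ?thesis by simp
qed (simp add: Omega_def)

lemma norm_Omega_le: "norm (Omega \<omega>) \<le> 1"
proof (cases "\<omega> = 0")
  case False
  have "norm (exp (- (\<i> * complex_of_real \<omega>)) - 1) \<le> \<bar>\<omega>\<bar>"
    using iexp_approx1[of "- \<omega>" 0] by simp
  then have "\<bar>\<omega>\<bar> * norm (Omega \<omega>) \<le> \<bar>\<omega>\<bar> * 1"
    using arg_cong[OF i_mult_Omega[of \<omega>], of norm] by (simp add: norm_mult norm_minus_commute)
  then show ?thesis using False by (simp add: mult_le_cancel_left)
qed (simp add: Omega_def)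

text \<open>Although \<open>ln\<close> is not additive, the arguments of \<open>\<i>\<omega>\<close> and \<open>\<Omega>(\<omega>)\<close> have opposite signs, the first
  one being \<open>\<plusminus>\<pi>/2\<close>.\<close>

lemma i_powr_mult_Omega_powr:
  "(\<i> * of_real \<omega>) powr a * Omega \<omega> powr a = (1 - exp (- (\<i> * of_real \<omega>))) powr a"
proof (cases "\<i> * of_real \<omega> * Omega \<omega> = 0")
  \<comment> \<open>Here \<omega> lies in 2 \<pi> Z. One of the two factors is 0, and since
    \<open>0 powr a = 0\<close> both sides vanish.\<close>
  case True
  then show ?thesis unfolding i_mult_Omega[symmetric] by auto
next
  case False
  then have w: "\<omega> \<noteq> 0" "Omega \<omega> \<noteq> 0" by auto
  have "cos \<omega> \<noteq> 1"
  proof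
    assume c: "cos \<omega> = 1"
    then have "sin \<omega> = 0" using sin_cos_squared_add[of \<omega>] by simp
    with c have "\<i> * of_real \<omega> * Omega \<omega> = 0" unfolding i_mult_Omega exp_minus_i by (simp add: complex_eq_iff)
    with False show False by simp
  qed
  then have c: "cos \<omega> < 1" using cos_le_one[of \<omega>] by linarith
  have "Ln (\<i> * of_real \<omega> * Omega \<omega>) = Ln (\<i> * of_real \<omega>) + Ln (Omega \<omega>)"
  proof (rule Ln_unique)
    show "exp (Ln (\<i> * of_real \<omega>) + Ln (Omega \<omega>)) = \<i> * of_real \<omega> * Omega \<omega>"
      using w by (simp add: exp_add)
    have "\<bar>Im (Ln (\<i> * of_real \<omega>) + Ln (Omega \<omega>))\<bar> < pi"
    proof (cases "\<omega> > 0")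
      case True
      have "Im (Omega \<omega>) < 0" using c True by (simp add: Im_Omega divide_less_0_iff)
      then have "- pi < Im (Ln (Omega \<omega>)) \<and> Im (Ln (Omega \<omega>)) < 0"
        using Im_Ln_pos_le[OF w(2)] mpi_less_Im_Ln[OF w(2)] Im_Ln_le_pi[OF w(2)] by auto
      moreover have "Im (Ln (\<i> * of_real \<omega>)) = pi / 2"
        using True by (subst Im_Ln_eq_pi_half) auto
      ultimately show ?thesis by auto
    next
      case False
      with w have "\<omega> < 0" by simp
      then have "Im (Omega \<omega>) > 0" using c by (simp add: Im_Omega zero_less_divide_iff)
      then have "0 < Im (Ln (Omega \<omega>)) \<and> Im (Ln (Omega \<omega>)) < pi"
        by (rule Im_Ln_pos_lt_imp)
      moreover have "Im (Ln (\<i> * of_real \<omega>)) = - pi / 2"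
        using \<open>\<omega> < 0\<close> by (subst Im_Ln_eq_pi_half) auto
      ultimately show ?thesis by auto
    qed
    then show "- pi < Im (Ln (\<i> * of_real \<omega>) + Ln (Omega \<omega>))"
      "Im (Ln (\<i> * of_real \<omega>) + Ln (Omega \<omega>)) \<le> pi" by auto
  qed
  then show ?thesis
    using w False unfolding i_mult_Omega[symmetric]
    by (simp add: powr_def distrib_left exp_add)
qed

text \<open>A complex exponent changes the modulus by exp (- Im a Arg z), and the principal argument
  is at most \<pi> in absolute value.\<close>

lemma norm_powr_complex_le: "norm (z powr a) \<le> norm z powr Re a * exp (pi * \<bar>Im a\<bar>)" for z a :: complex
proof -
  have "- Im a * Arg z \<le> \<bar>Im a\<bar> * \<bar>Arg z\<bar>"
    by (metis abs_ge_self abs_minus_cancel abs_mult)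
  also have "\<dots> \<le> \<bar>Im a\<bar> * pi"
    using Arg_bounded[of z] by (intro mult_left_mono) auto
  finally show ?thesis
    unfolding norm_powr_complex by (intro mult_left_mono) (auto simp: mult.commute)
qed

lemma norm_Omega_powr_le: "Re a > 0 \<Longrightarrow> norm (Omega \<omega> powr a) \<le> exp (pi * \<bar>Im a\<bar>)"
  by (rule order_trans[OF norm_powr_complex_le])
     (use norm_Omega_le[of \<omega>] in \<open>simp add: powr_le1\<close>)

text \<open>The two powers combine to a power of 1 - exp (- i \<omega>), a number of modulus at most
  2, so the growth of the first factor disappears.\<close>

lemma norm_i_powr_mult_Omega_powr_le:
  assumes "Re a > 0"
  shows "norm ((\<i> * of_real \<omega>) powr a * Omega \<omega> powr a) \<le> 2 powr Re a * exp (pi * \<bar>Im a\<bar>)"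
proof -
  have "norm (1 - exp (- (\<i> * complex_of_real \<omega>))) \<le> 2"
    by (rule order_trans[OF norm_triangle_ineq4]) (simp add: norm_exp_eq_Re)
  then show ?thesis
    unfolding i_powr_mult_Omega_powr using assms
    by (intro order_trans[OF norm_powr_complex_le] mult_right_mono powr_mono2) auto
qed

lemma Omega_measurable [measurable]: "Omega \<in> borel_measurable borel"
  unfolding Omega_def[abs_def] by measurable

lemma Omega_powr_measurable [measurable]: "(\<lambda>\<omega>. Omega \<omega> powr a) \<in> borel_measurable borel"
  by measurable

lemma i_powr_measurable [measurable]: "(\<lambda>\<omega>. (\<i> * complex_of_real \<omega>) powr a) \<in> borel_measurable borel"
  by measurable

text \<open>The exceptional frequencies are those at which the binomial series would be evaluated at
  -1; there are only countably many.\<close>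

lemma AE_exp_minus_i_neq_1: "AE \<omega> in lborel. exp (- (\<i> * complex_of_real \<omega>)) \<noteq> 1"
proof (rule AE_I')
  show "range (\<lambda>n::int. 2 * pi * real_of_int n) \<in> null_sets lborel"
    by (intro countable_imp_null_set_lborel countable_image) simp
  show "{\<omega> \<in> space lborel. \<not> exp (- (\<i> * complex_of_real \<omega>)) \<noteq> 1} \<subseteq> range (\<lambda>n::int. 2 * pi * real_of_int n)"
    by (auto simp: exp_minus_i complex_eq_iff Complex_eq_1 cos_one_2pi_int) 
qed

lemma i_powr_mult_Omega_powr_sums:
  assumes a: "Re a > 0" and w: "exp (- (\<i> * complex_of_real \<omega>)) \<noteq> 1"
  shows "(\<lambda>k. (-1) ^ k * (a gchoose k) * exp (- (\<i> * of_real (real k) * of_real \<omega>)))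
    sums ((\<i> * of_real \<omega>) powr a * Omega \<omega> powr a)"
proof -
  let ?e = "exp (- (\<i> * complex_of_real \<omega>))"
  have "(\<lambda>k. (a gchoose k) * (- ?e) ^ k) sums (1 + - ?e) powr a"
    using w by (intro gen_binomial_complex_circle a) (auto simp: norm_exp_eq_Re)
  moreover have "(- ?e) ^ k = (-1) ^ k * exp (- (\<i> * of_real (real k) * of_real \<omega>))" for k
    by (subst power_minus) (simp add: mult_ac flip: exp_of_nat_mult)
  ultimately show ?thesis
    unfolding i_powr_mult_Omega_powr by (simp add: mult_ac)
qed

section \<open>Tempered distributions with values in the complex paravectors\<close>

lemma norm_smult: "norm (c *s v) = norm c * norm (v :: 'a::finite cliff)"
  by (simp add: norm_vec_def norm_mult L2_set_right_distrib)

lemma scaleR_eq_smult: "r *\<^sub>R v = complex_of_real r *s (v :: 'a::finite cliff)"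
  by (simp only: vec_eq_iff vector_scaleR_component vector_smult_component) (simp only: scaleR_conv_of_real, simp)

lemma bounded_bilinear_smult: "bounded_bilinear ((*s) :: complex \<Rightarrow> 'a::finite cliff \<Rightarrow> 'a cliff)"
  by (rule bounded_bilinear.intro)
     (auto simp: vec_eq_iff algebra_simps norm_smult intro!: exI[of _ 1])

lemmas bounded_linear_smult_left = bounded_bilinear.bounded_linear_left[OF bounded_bilinear_smult]

lemma measurable_smult [measurable (raw)]:
  fixes g :: "'b \<Rightarrow> 'a::finite cliff"
  assumes "f \<in> borel_measurable M" "g \<in> borel_measurable M"
  shows "(\<lambda>x. f x *s g x) \<in> borel_measurable M"
  by (rule borel_measurable_continuous_Pair[OF assms])
     (intro bounded_bilinear.continuous_on[OF bounded_bilinear_smult] continuous_intros)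

lemma cparavectors_smult: "P \<in> cparavectors \<Longrightarrow> c *s P \<in> cparavectors"
  and cparavectors_add: "P \<in> cparavectors \<Longrightarrow> Q \<in> cparavectors \<Longrightarrow> P + Q \<in> cparavectors"
  and cparavectors_zero: "0 \<in> cparavectors"
  and cparavectors_one: "cl_one \<in> cparavectors"
  unfolding cparavectors_def
  by (auto intro: vec.span_scale vec.span_add vec.span_zero vec.span_base)

lemma schwartz_seminorm_nonneg: "f \<in> schwartz \<Longrightarrow> 0 \<le> schwartz_seminorm m k f"
  by (rule order_trans[OF norm_ge_zero schwartz_bound])

definition seminorm_sum :: "nat \<Rightarrow> (real \<Rightarrow> complex) \<Rightarrow> real" where
  "seminorm_sum N f = (\<Sum>m\<le>N. \<Sum>k\<le>N. schwartz_seminorm m k f)"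

lemma seminorm_sum_nonneg: "f \<in> schwartz \<Longrightarrow> 0 \<le> seminorm_sum N f"
  unfolding seminorm_sum_def by (intro sum_nonneg schwartz_seminorm_nonneg)

lemma seminorm_sum_mono:
  assumes "f \<in> schwartz" "M \<le> N"
  shows "seminorm_sum M f \<le> seminorm_sum N f"
proof -
  have "seminorm_sum M f \<le> (\<Sum>m\<le>M. \<Sum>k\<le>N. schwartz_seminorm m k f)"
    unfolding seminorm_sum_def
    by (intro sum_mono sum_mono2) (use assms in \<open>auto intro: schwartz_seminorm_nonneg\<close>)
  also have "\<dots> \<le> seminorm_sum N f"
    unfolding seminorm_sum_def
    by (intro sum_mono2) (use assms in \<open>auto intro!: sum_nonneg schwartz_seminorm_nonneg\<close>)
  finally show ?thesis .
qed

text \<open>Linearity and continuity of a single spectral component. Coefficients with respect to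
  two fixed paravectors suffice for every distribution constructed below.\<close>

definition scalar_tempered :: "((real \<Rightarrow> complex) \<Rightarrow> complex) \<Rightarrow> bool" where
  "scalar_tempered t \<longleftrightarrow>
     (\<forall>f\<in>schwartz. \<forall>g\<in>schwartz. \<forall>c. t (\<lambda>x. c * f x + g x) = c * t f + t g) \<and>
     (\<exists>N C. \<forall>f\<in>schwartz. norm (t f) \<le> C * seminorm_sum N f)"

lemma scalar_temperedI:
  assumes "\<And>f g c. f \<in> schwartz \<Longrightarrow> g \<in> schwartz \<Longrightarrow> t (\<lambda>x. c * f x + g x) = c * t f + t g"
    and "\<And>f. f \<in> schwartz \<Longrightarrow> norm (t f) \<le> C * seminorm_sum N f"
  shows "scalar_tempered t"
  using assms unfolding scalar_tempered_def by blast

lemma tempered_combination: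
  assumes s: "scalar_tempered s" and t: "scalar_tempered t"
    and PQ: "P \<in> cparavectors" "Q \<in> cparavectors"
  shows "tempered (on_schwartz (\<lambda>f. s f *s P + t f *s Q))"
proof -
  obtain M C where s_le: "\<And>f. f \<in> schwartz \<Longrightarrow> norm (s f) \<le> C * seminorm_sum M f"
    using s unfolding scalar_tempered_def by blast
  obtain N D where t_le: "\<And>f. f \<in> schwartz \<Longrightarrow> norm (t f) \<le> D * seminorm_sum N f"
    using t unfolding scalar_tempered_def by blast
  \<comment> \<open>The two functionals may have different orders; the larger one serves both. The
    constants are only known as real numbers, so their absolute values are taken before enlarging
    the seminorms.\<close>
  have "norm (s f *s P + t f *s Q) \<le> (\<bar>C\<bar> * norm P + \<bar>D\<bar> * norm Q) * seminorm_sum (max M N) f"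
    if f: "f \<in> schwartz" for f
  proof -
    have "norm (s f) \<le> \<bar>C\<bar> * seminorm_sum (max M N) f"
      by (rule order_trans[OF s_le[OF f]], rule mult_mono)
         (use f in \<open>auto intro: seminorm_sum_mono seminorm_sum_nonneg\<close>)
    moreover have "norm (t f) \<le> \<bar>D\<bar> * seminorm_sum (max M N) f"
      by (rule order_trans[OF t_le[OF f]], rule mult_mono)
         (use f in \<open>auto intro: seminorm_sum_mono seminorm_sum_nonneg\<close>)
    ultimately have "norm (s f) * norm P + norm (t f) * norm Q
        \<le> \<bar>C\<bar> * seminorm_sum (max M N) f * norm P + \<bar>D\<bar> * seminorm_sum (max M N) f * norm Q"
      by (intro add_mono mult_right_mono) auto
    then show ?thesis
      using norm_triangle_ineq[of "s f *s P" "t f *s Q"] by (simp add: norm_smult algebra_simps)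
  qed
  then have "\<exists>N C. \<forall>f\<in>schwartz. norm (on_schwartz (\<lambda>f. s f *s P + t f *s Q) f) \<le>
      C * (\<Sum>m\<le>N. \<Sum>k\<le>N. schwartz_seminorm m k f)"
    unfolding seminorm_sum_def on_schwartz_def by auto
  moreover have "on_schwartz (\<lambda>f. s f *s P + t f *s Q) (\<lambda>x. c * f x + g x)
     = c *s on_schwartz (\<lambda>f. s f *s P + t f *s Q) f + on_schwartz (\<lambda>f. s f *s P + t f *s Q) g"
    if "f \<in> schwartz" "g \<in> schwartz" for f g c
    using s t that unfolding scalar_tempered_def
    by (simp add: on_schwartz_def schwartz_lincomb)
  moreover have "range (on_schwartz (\<lambda>f. s f *s P + t f *s Q)) \<subseteq> cparavectors"
    using PQ by (auto simp: on_schwartz_def intro: cparavectors_add cparavectors_smult cparavectors_zero)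
  moreover have "on_schwartz (on_schwartz (\<lambda>f. s f *s P + t f *s Q)) = on_schwartz (\<lambda>f. s f *s P + t f *s Q)"
    by (simp add: on_schwartz_def fun_eq_iff)
  ultimately show ?thesis
    unfolding tempered_def by blast
qed

lemma seminorm_sum_ge:
  assumes "f \<in> schwartz" "m \<le> N" "k \<le> N"
  shows "schwartz_seminorm m k f \<le> seminorm_sum N f"
proof -
  have "schwartz_seminorm m k f \<le> (\<Sum>k\<le>N. schwartz_seminorm m k f)"
    by (rule member_le_sum) (use assms in \<open>auto intro: schwartz_seminorm_nonneg\<close>)
  also have "\<dots> \<le> seminorm_sum N f"
    unfolding seminorm_sum_def
    by (rule member_le_sum[where f = "\<lambda>m. \<Sum>k\<le>N. schwartz_seminorm m k f"])
       (use assms in \<open>auto intro!: sum_nonneg schwartz_seminorm_nonneg\<close>)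
  finally show ?thesis .
qed

lemma scalar_tempered_eval: "scalar_tempered (\<lambda>f. f a * c)"
proof (rule scalar_temperedI[where N = 0 and C = "norm c"])
  fix f assume f: "f \<in> schwartz"
  show "norm (f a * c) \<le> norm c * seminorm_sum 0 f"
    using mult_left_mono[OF order_trans[OF schwartz_norm_le[OF f, of a] seminorm_sum_ge[OF f, of 0 0 0]], of "norm c"]
    by (simp add: norm_mult mult.commute)
qed (simp add: algebra_simps)

lemma schwartz_series_summable:
  assumes f: "f \<in> schwartz" and c: "summable (\<lambda>k. norm (c k))"
  shows "summable (\<lambda>k. norm (f (a k) * c k))"
    and "(\<Sum>k. norm (f (a k) * c k)) \<le> (\<Sum>k. norm (c k)) * seminorm_sum 0 f"
proof -
  have le: "norm (f (a k) * c k) \<le> norm (c k) * seminorm_sum 0 f" for k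
    using mult_left_mono[OF order_trans[OF schwartz_norm_le[OF f, of "a k"] seminorm_sum_ge[OF f, of 0 0 0]], of "norm (c k)"]
    by (simp add: norm_mult mult.commute)
  have S: "summable (\<lambda>k. norm (c k) * seminorm_sum 0 f)"
    by (rule summable_mult2[OF c])
  show sm: "summable (\<lambda>k. norm (f (a k) * c k))"
    by (rule summable_comparison_test'[OF S, of 0]) (use le in simp)
  show "(\<Sum>k. norm (f (a k) * c k)) \<le> (\<Sum>k. norm (c k)) * seminorm_sum 0 f"
    using suminf_le[OF le sm S] suminf_mult2[OF c, of "seminorm_sum 0 f"] by simp
qed

text \<open>Each term is at most the supremum norm of the test function times
  \<open>norm (c k)\<close>. An l1 combination of point evaluations is therefore continuous with no
  derivatives involved, whence \<open>N = 0\<close>.\<close>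

lemma scalar_tempered_series:
  assumes c: "summable (\<lambda>k. norm (c k))"
  shows "scalar_tempered (\<lambda>f. \<Sum>k. f (a k) * c k)"
proof (rule scalar_temperedI[where N = 0 and C = "\<Sum>k. norm (c k)"])
  fix f g and d :: complex assume fg: "f \<in> schwartz" "g \<in> schwartz"
  note S = schwartz_series_summable(1)[OF fg(1) c, THEN summable_norm_cancel, of a]
    schwartz_series_summable(1)[OF fg(2) c, THEN summable_norm_cancel, of a]
  have "(\<Sum>k. (d * f (a k) + g (a k)) * c k) = (\<Sum>k. d * (f (a k) * c k) + g (a k) * c k)"
    by (simp add: algebra_simps)
  also have "\<dots> = (\<Sum>k. d * (f (a k) * c k)) + (\<Sum>k. g (a k) * c k)"
    by (rule suminf_add[symmetric]) (intro summable_mult S)+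
  also have "(\<Sum>k. d * (f (a k) * c k)) = d * (\<Sum>k. f (a k) * c k)"
    by (rule suminf_mult[OF S(1)])
  finally show "(\<Sum>k. (d * f (a k) + g (a k)) * c k) = d * (\<Sum>k. f (a k) * c k) + (\<Sum>k. g (a k) * c k)" .
next
  fix f assume f: "f \<in> schwartz"
  show "norm (\<Sum>k. f (a k) * c k) \<le> (\<Sum>k. norm (c k)) * seminorm_sum 0 f"
    using summable_norm[OF schwartz_series_summable(1)[OF f c, of a]]
      schwartz_series_summable(2)[OF f c, of a] by linarith
qed

lemma integrable_schwartz_mult_bounded:
  fixes h :: "real \<Rightarrow> complex"
  assumes f: "f \<in> schwartz" and [measurable]: "h \<in> borel_measurable borel" and h: "\<And>x. norm (h x) \<le> K"
  shows "integrable lborel (\<lambda>x. f x * h x)"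
proof (rule Bochner_Integration.integrable_bound)
  show "integrable lborel (\<lambda>x. K * norm (f x))"
    by (intro integrable_mult_right integrable_norm schwartz_integrable f)
  have [measurable]: "f \<in> borel_measurable borel" using f by (rule schwartz_measurable)
  show "(\<lambda>x. f x * h x) \<in> borel_measurable lborel" by measurable
  have K: "K \<ge> 0" using order_trans[OF norm_ge_zero h[of 0]] .
  show "AE x in lborel. norm (f x * h x) \<le> norm (K * norm (f x))"
    using mult_right_mono[OF h norm_ge_zero] K by (auto simp: norm_mult mult.commute abs_mult)
qed

text \<open>This functional is the inverse Fourier transform of \<open>h\<close>, defined by
  duality. In the constant, the four seminorms of \<open>fourier_decay\<close> divided by the 2 of 2
  \<pi> leave 2, and \<pi> is the integral of the weight.\<close>

lemma scalar_tempered_integral_inv_fourier: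
  assumes [measurable]: "h \<in> borel_measurable borel" and h: "\<And>x. norm (h x) \<le> K"
  shows "scalar_tempered (\<lambda>f. \<integral>x. inv_fourier f x * h x \<partial>lborel)"
proof (rule scalar_temperedI[where N = 2 and C = "2 * pi * K"])
  fix f g and d :: complex assume fg: "f \<in> schwartz" "g \<in> schwartz"
  have int: "integrable lborel (\<lambda>x. inv_fourier f x * h x)" "integrable lborel (\<lambda>x. inv_fourier g x * h x)"
    by (intro integrable_schwartz_mult_bounded[OF _ _ h] inv_fourier_schwartz fg; measurable)+
  have "(\<integral>x. inv_fourier (\<lambda>x. d * f x + g x) x * h x \<partial>lborel)
    = (\<integral>x. d * (inv_fourier f x * h x) + inv_fourier g x * h x \<partial>lborel)"
    unfolding inv_fourier_lincomb[OF fg] by (simp add: algebra_simps)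
  also have "\<dots> = d * (\<integral>x. inv_fourier f x * h x \<partial>lborel) + (\<integral>x. inv_fourier g x * h x \<partial>lborel)"
    by (subst Bochner_Integration.integral_add) (use int in auto)
  finally show "(\<integral>x. inv_fourier (\<lambda>x. d * f x + g x) x * h x \<partial>lborel)
     = d * (\<integral>x. inv_fourier f x * h x \<partial>lborel) + (\<integral>x. inv_fourier g x * h x \<partial>lborel)" .
next
  fix f assume f: "f \<in> schwartz"
  let ?S = "seminorm_sum 2 f"
  have K: "K \<ge> 0" using order_trans[OF norm_ge_zero h[of 0]] .
  have S: "?S \<ge> 0" by (rule seminorm_sum_nonneg[OF f])
  have le: "norm (inv_fourier f x * h x) \<le> 2 * K * ?S * inverse (1 + x\<^sup>2)" for x
  proof -
    have "norm (fourier f (- x)) \<le> pi * (4 * ?S) * inverse (1 + x\<^sup>2)"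
      by (rule order_trans[OF fourier_decay[OF f]], unfold power2_minus, intro mult_right_mono mult_left_mono)
         (use seminorm_sum_ge[OF f, of 0 2 0] seminorm_sum_ge[OF f, of 2 2 0]
           seminorm_sum_ge[OF f, of 0 2 2] seminorm_sum_ge[OF f, of 2 2 2] in auto)
    then have "norm (inv_fourier f x) \<le> 2 * ?S * inverse (1 + x\<^sup>2)"
      by (simp add: inv_fourier_def norm_divide norm_mult field_simps)
    then have "norm (inv_fourier f x) * norm (h x) \<le> (2 * ?S * inverse (1 + x\<^sup>2)) * K"
      by (rule mult_mono) (use h S in auto)
    then show ?thesis by (simp add: norm_mult mult_ac)
  qed
  have "norm (\<integral>x. inv_fourier f x * h x \<partial>lborel) \<le> (\<integral>x. 2 * K * ?S * inverse (1 + x\<^sup>2) \<partial>lborel)"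
    by (rule Bochner_Integration.integral_norm_bound_integral)
       (use f le in \<open>auto intro!: integrable_mult_right integrable_inverse_1_plus_square_lborel
         integrable_schwartz_mult_bounded[OF _ _ h] inv_fourier_schwartz\<close>)
  also have "\<dots> = 2 * K * ?S * pi"
    by (simp only: integral_mult_right_zero integral_inverse_1_plus_square_lborel)
  finally show "norm (\<integral>x. inv_fourier f x * h x \<partial>lborel) \<le> 2 * pi * K * ?S"
    by (simp add: mult_ac)
qed

lemma distr_of_combination:
  fixes P Q :: "'n::{finite,linorder} cliff"
  assumes "a \<in> borel_measurable borel" "\<And>x. norm (a x) \<le> K"
    and "b \<in> borel_measurable borel" "\<And>x. norm (b x) \<le> L"
  shows "distr_of (\<lambda>x. a x *s P + b x *s Q)
    = on_schwartz (\<lambda>f. (\<integral>x. f x * a x \<partial>lborel) *s P + (\<integral>x. f x * b x \<partial>lborel) *s Q)"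
proof -
  have "(\<integral>x. f x *s (a x *s P + b x *s Q) \<partial>lborel)
      = (\<integral>x. f x * a x \<partial>lborel) *s P + (\<integral>x. f x * b x \<partial>lborel) *s Q" if f: "f \<in> schwartz" for f
  proof -
    note int = integrable_schwartz_mult_bounded[OF f assms(1,2)] integrable_schwartz_mult_bounded[OF f assms(3,4)]
    have "(\<integral>x. f x *s (a x *s P + b x *s Q) \<partial>lborel) = (\<integral>x. (f x * a x) *s P + (f x * b x) *s Q \<partial>lborel)"
      by (intro Bochner_Integration.integral_cong refl) (simp add: vec_eq_iff algebra_simps)
    also have "\<dots> = (\<integral>x. (f x * a x) *s P \<partial>lborel) + (\<integral>x. (f x * b x) *s Q \<partial>lborel)"
      by (intro Bochner_Integration.integral_add integrable_bounded_linear[OF bounded_linear_smult_left] int)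
    also have "\<dots> = (\<integral>x. f x * a x \<partial>lborel) *s P + (\<integral>x. f x * b x \<partial>lborel) *s Q"
      using int by (simp add: integral_bounded_linear[OF bounded_linear_smult_left])
    finally show ?thesis .
  qed
  then show ?thesis by (auto simp: distr_of_def on_schwartz_def fun_eq_iff)
qed

lemma poly_growth_combination:
  fixes P Q :: "'n::{finite,linorder} cliff"
  assumes [measurable]: "a \<in> borel_measurable borel" and a: "\<And>x. norm (a x) \<le> K"
    and [measurable]: "b \<in> borel_measurable borel" and b: "\<And>x. norm (b x) \<le> L"
    and PQ: "P \<in> cparavectors" "Q \<in> cparavectors"
  shows "poly_growth (\<lambda>x. a x *s P + b x *s Q)"
proof -
  have "norm (a x *s P + b x *s Q) \<le> K * norm P + L * norm Q" for x
    by (rule order_trans[OF norm_triangle_ineq])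
       (auto simp: norm_smult intro!: add_mono mult_right_mono a b)
  then have "\<exists>N C. \<forall>x::real. norm (a x *s P + b x *s Q) \<le> C * (1 + \<bar>x\<bar>) ^ N"
    by (intro exI[of _ 0] exI[of _ "K * norm P + L * norm Q"]) simp
  then show ?thesis
    unfolding poly_growth_def using PQ by (auto intro: cparavectors_add cparavectors_smult)
qed

lemma poly_growth_component:
  fixes g :: "real \<Rightarrow> 'n::{finite,linorder} cliff"
  assumes "poly_growth g"
  shows "(\<lambda>x. g x $ A) \<in> borel_measurable borel" and "\<exists>C N. \<forall>x. norm (g x $ A) \<le> C * (1 + \<bar>x\<bar>) ^ N"
proof -
  have g: "g \<in> borel_measurable borel" using assms by (simp add: poly_growth_def)
  show "(\<lambda>x. g x $ A) \<in> borel_measurable borel"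
    by (rule measurable_compose[OF g borel_measurable_continuous_onI]) (intro continuous_intros)
  obtain N C where "\<And>x. norm (g x) \<le> C * (1 + \<bar>x\<bar>) ^ N"
    using assms unfolding poly_growth_def by blast
  then have "norm (g x $ A) \<le> C * (1 + \<bar>x\<bar>) ^ N" for x
    by (rule order_trans[OF Finite_Cartesian_Product.norm_nth_le])
  then show "\<exists>C N. \<forall>x. norm (g x $ A) \<le> C * (1 + \<bar>x\<bar>) ^ N" by blast
qed

text \<open>Up to the factor \<open>2 ^ N\<close>, a power of \<open>1 + \<bar>x\<bar>\<close> is at
  most \<open>1 + \<bar>x\<bar> ^ N\<close>, and \<open>x ^ N *\<^sub>R f x\<close> is again
  Schwartz, hence integrable.\<close>

lemma schwartz_growth_integrable:
  assumes f: "f \<in> schwartz"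
  shows "integrable lborel (\<lambda>x. C * (1 + \<bar>x\<bar>) ^ N * norm (f x))"
proof (rule Bochner_Integration.integrable_bound)
  have X: "(\<lambda>x. x ^ N *\<^sub>R f x) \<in> schwartz"
    by (induction N) (use f schwartz_mult_x in \<open>auto simp flip: scaleR_scaleR\<close>)
  show "integrable lborel (\<lambda>x. \<bar>C\<bar> * 2 ^ N * (norm (f x) + norm (x ^ N *\<^sub>R f x)))"
    by (intro integrable_mult_right Bochner_Integration.integrable_add integrable_norm schwartz_integrable f X)
  have [measurable]: "f \<in> borel_measurable borel" using f by (rule schwartz_measurable)
  show "(\<lambda>x. C * (1 + \<bar>x\<bar>) ^ N * norm (f x)) \<in> borel_measurable lborel" by measurable
  have "(1 + \<bar>x\<bar>) ^ N \<le> 2 ^ N * (1 + \<bar>x\<bar> ^ N)" for x :: real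
  proof -
    have "(1 + \<bar>x\<bar>) ^ N \<le> (2 * max 1 \<bar>x\<bar>) ^ N"
      by (intro power_mono) (auto simp: max_def)
    also have "\<dots> \<le> 2 ^ N * (1 + \<bar>x\<bar> ^ N)"
      unfolding power_mult_distrib by (intro mult_left_mono) (auto simp: max_def)
    finally show ?thesis .
  qed
  then have "\<bar>C\<bar> * (1 + \<bar>x\<bar>) ^ N * norm (f x) \<le> \<bar>C\<bar> * (2 ^ N * (1 + \<bar>x\<bar> ^ N)) * norm (f x)" for x
    by (intro mult_left_mono mult_right_mono) auto
  then show "AE x in lborel. norm (C * (1 + \<bar>x\<bar>) ^ N * norm (f x))
      \<le> norm (\<bar>C\<bar> * 2 ^ N * (norm (f x) + norm (x ^ N *\<^sub>R f x)))"
    by (auto simp: abs_mult power_abs algebra_simps)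
qed

lemma integrable_schwartz_smult:
  fixes g :: "real \<Rightarrow> 'n::{finite,linorder} cliff"
  assumes f: "f \<in> schwartz" and g: "poly_growth g"
  shows "integrable lborel (\<lambda>x. f x *s g x)"
proof -
  have [measurable]: "g \<in> borel_measurable borel" using g by (simp add: poly_growth_def)
  have [measurable]: "f \<in> borel_measurable borel" using f by (rule schwartz_measurable)
  obtain N C where CN: "\<And>x. norm (g x) \<le> C * (1 + \<bar>x\<bar>) ^ N"
    using g unfolding poly_growth_def by blast
  show ?thesis
  proof (rule Bochner_Integration.integrable_bound[OF schwartz_growth_integrable[OF f]])
    show "AE x in lborel. norm (f x *s g x) \<le> norm (C * (1 + \<bar>x\<bar>) ^ N * norm (f x))"
    proof (rule AE_I2)
      fix x
      have "norm (f x *s g x) \<le> C * (1 + \<bar>x\<bar>) ^ N * norm (f x)"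
        unfolding norm_smult using mult_right_mono[OF CN norm_ge_zero] by (simp add: mult.commute)
      then show "norm (f x *s g x) \<le> norm (C * (1 + \<bar>x\<bar>) ^ N * norm (f x))"
        by (rule order_trans) (simp only: real_norm_def abs_ge_self)
    qed
  qed measurable
qed

text \<open>Uniqueness is applied to the difference of each coefficient in the blade basis; there
  are finitely many, so the exceptional null sets can be merged.\<close>

lemma distr_of_inject_AE:
  fixes g h :: "real \<Rightarrow> 'n::{finite,linorder} cliff"
  assumes g: "poly_growth g" and h: "poly_growth h" and eq: "distr_of g = distr_of h"
  shows "AE x in lborel. g x = h x"
proof -
  have "AE x in lborel. g x $ A - h x $ A = 0" for A
  proof -
    obtain C N where C: "\<And>x. norm (g x $ A) \<le> C * (1 + \<bar>x\<bar>) ^ N"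
      using poly_growth_component(2)[OF g] by blast
    obtain D M where D: "\<And>x. norm (h x $ A) \<le> D * (1 + \<bar>x\<bar>) ^ M"
      using poly_growth_component(2)[OF h] by blast
    note [measurable] = poly_growth_component(1)[OF g, of A] poly_growth_component(1)[OF h, of A]
    have "norm (g x $ A - h x $ A) \<le> (\<bar>C\<bar> + \<bar>D\<bar>) * (1 + \<bar>x\<bar>) ^ (M + N)" for x
    proof -
      have "norm (g x $ A) \<le> \<bar>C\<bar> * (1 + \<bar>x\<bar>) ^ (M + N)"
        by (rule order_trans[OF C], rule mult_mono) (auto intro!: power_increasing)
      moreover have "norm (h x $ A) \<le> \<bar>D\<bar> * (1 + \<bar>x\<bar>) ^ (M + N)"
        by (rule order_trans[OF D], rule mult_mono) (auto intro!: power_increasing)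
      ultimately show ?thesis
        using norm_triangle_ineq4[of "g x $ A" "h x $ A"] by (simp add: distrib_right)
    qed
    moreover have "(\<integral>x. f x * (g x $ A - h x $ A) \<partial>lborel) = 0" if f: "f \<in> schwartz" for f
    proof -
      note int = integrable_schwartz_smult[OF f g] integrable_schwartz_smult[OF f h]
      have "(\<integral>x. f x *s g x \<partial>lborel) = (\<integral>x. f x *s h x \<partial>lborel)"
        using fun_cong[OF eq, of f] f by (simp add: distr_of_def on_schwartz_def)
      then have "(\<integral>x. f x *s g x - f x *s h x \<partial>lborel) $ A = 0"
        using int by simp
      also have "(\<integral>x. f x *s g x - f x *s h x \<partial>lborel) $ A = (\<integral>x. (f x *s g x - f x *s h x) $ A \<partial>lborel)"
        by (rule integral_bounded_linear[symmetric])
           (intro bounded_linear_vec_nth Bochner_Integration.integrable_diff int)+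
      finally show ?thesis by (simp add: algebra_simps)
    qed
    ultimately show ?thesis
      by (intro AE_eq_0_if_schwartz_integrals) measurable
  qed
  then have "AE x in lborel. \<forall>A. g x $ A - h x $ A = 0"
    by (subst AE_all_countable) auto
  then show ?thesis by eventually_elim (simp add: vec_eq_iff)
qed

lemma distr_of_cong_AE:
  fixes g h :: "real \<Rightarrow> 'n::{finite,linorder} cliff"
  assumes g: "poly_growth g" and h: "poly_growth h" and eq: "AE x in lborel. g x = h x"
  shows "distr_of g = distr_of h"
proof -
  have "(\<integral>x. f x *s g x \<partial>lborel) = (\<integral>x. f x *s h x \<partial>lborel)" if f: "f \<in> schwartz" for f
    using integrable_schwartz_smult[OF f g] integrable_schwartz_smult[OF f h] eq
    by (intro integral_cong_AE) auto
  then show ?thesis by (auto simp: distr_of_def on_schwartz_def fun_eq_iff)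
qed

section \<open>Spectral decomposition of paravectors\<close>

lemma vector_part_square:
  fixes a :: "'n::{finite,linorder} cliff"
  shows "vector_part a \<odot> vector_part a = - (of_real ((vector_abs a)\<^sup>2) *s cl_one)"
proof -
  define x where "x = (\<lambda>i. complex_of_real (Re (a $ {i})))"
  have v: "vector_part a = (\<Sum>i\<in>UNIV. x i *s cl_gen i)"
    unfolding vector_part_def x_def by (intro sum.cong refl) (simp add: vec_eq_iff scaleR_eq_smult)
  have V: "vector_part a \<odot> vector_part a = (\<Sum>i\<in>UNIV. \<Sum>j\<in>UNIV. (x i * x j) *s (cl_gen i \<odot> cl_gen j))"
    unfolding v by (simp add: cl_mult_sum_left cl_mult_sum_right cl_mult_smult_left cl_mult_smult_right)
      (simp add: vec.scale_sum_right, subst sum.swap, simp add: mult.commute)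
  also have "\<dots> = (\<Sum>i\<in>UNIV. \<Sum>j\<in>UNIV. (x i * x j) *s (cl_gen j \<odot> cl_gen i))"
    by (subst sum.swap) (simp add: mult.commute)
  \<comment> \<open>Adding the double sum to its transpose produces anticommutators, of which only
    the diagonal survives.\<close>
  finally have "2 *s (vector_part a \<odot> vector_part a)
      = (\<Sum>i\<in>UNIV. \<Sum>j\<in>UNIV. (x i * x j) *s (cl_gen i \<odot> cl_gen j + cl_gen j \<odot> cl_gen i))"
    using V by (simp add: vec.scale_right_distrib sum.distrib vec_eq_iff)
  also have "\<dots> = (\<Sum>i\<in>UNIV. \<Sum>j\<in>UNIV. if i = j then (-2 * (x i)\<^sup>2) *s (cl_one :: 'n cliff) else 0)"
    unfolding cl_gen_anticommute by (intro sum.cong refl) (simp add: power2_eq_square)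
  also have "\<dots> = (\<Sum>i\<in>UNIV. -2 * (x i)\<^sup>2) *s cl_one"
    by (simp add: vec.scale_sum_left)
  also have "(\<Sum>i\<in>UNIV. -2 * (x i)\<^sup>2) = -2 * of_real ((vector_abs a)\<^sup>2)"
    by (simp add: vector_abs_def x_def sum_nonneg sum_distrib_left)
  finally have "(1 / 2) *s (2 *s (vector_part a \<odot> vector_part a))
      = (1 / 2) *s ((-2 * of_real ((vector_abs a)\<^sup>2)) *s cl_one)"
    by (rule arg_cong)
  then show ?thesis by (simp only: vec.scale_scale) (simp del: of_real_power)
qed

lemma vector_part_eq_0: "vector_abs a = 0 \<Longrightarrow> vector_part a = 0"
  by (simp add: vector_abs_def vector_part_def sum_nonneg_eq_0_iff)

lemma vector_part_cparavectors: "vector_part a \<in> cparavectors"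
proof -
  have "vector_part a = (\<Sum>i\<in>UNIV. of_real (Re (a $ {i})) *s cl_gen i)"
    unfolding vector_part_def by (intro sum.cong refl) (simp add: vec_eq_iff scaleR_eq_smult)
  then show ?thesis
    by (simp only: cparavectors_def) (intro vec.span_sum vec.span_scale vec.span_base, simp)
qed

text \<open>A pair \<open>(z, w)\<close> of complex numbers stands for \<open>z P + w Q\<close>, with orthogonal idempotents \<open>P\<close> and \<open>Q\<close>.
  If \<open>v = 0\<close>, then \<open>P = 1\<close> and \<open>Q = 0\<close>.\<close>

locale spectral_decomposition =
  fixes \<Upsilon> P Q :: "'n::{finite,linorder} cliff" and l m :: complex
  assumes P: "P \<in> cparavectors" and Q: "Q \<in> cparavectors"
    and mult: "\<And>a b c d. (a *s P + b *s Q) \<odot> (c *s P + d *s Q) = (a * c) *s P + (b * d) *s Q"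
    and one: "cl_one = P + Q"
    and decomp: "\<Upsilon> = l *s P + m *s Q"
    and hpow: "\<And>z. hpow z \<Upsilon> = (z powr l) *s P + (z powr m) *s Q"
    and Re: "Re l = scalar_part \<Upsilon>" "Re m = scalar_part \<Upsilon>"

lemma spectral_decomposition_exists:
  fixes \<Upsilon> :: "'n::{finite,linorder} cliff"
  assumes "\<Upsilon> \<in> paravectors"
  shows "\<exists>P Q l m. spectral_decomposition \<Upsilon> P Q l m"
proof (cases "vector_abs \<Upsilon> = 0")
  case True
  let ?l = "complex_of_real (scalar_part \<Upsilon>)"
  have U: "\<Upsilon> = ?l *s cl_one"
    using paravector_decomp[OF assms] vector_part_eq_0[OF True]
    by (simp add: vec_eq_iff scaleR_eq_smult)
  \<comment> \<open>With \<open>Q = 0\<close> the second exponent only has to have the right real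
    part; it is taken equal to the first.\<close>
  have "spectral_decomposition \<Upsilon> cl_one 0 ?l ?l"
  proof
    show "hpow z \<Upsilon> = (z powr ?l) *s cl_one + (z powr ?l) *s 0" for z
      by (simp add: hpow_def True vector_part_eq_0 vec_eq_iff)
    show "\<Upsilon> = ?l *s cl_one + ?l *s 0" using U by simp
  qed (auto simp: cparavectors_zero cparavectors_one cl_mult_smult_left cl_mult_smult_right mult.commute)
  then show ?thesis by blast
next
  case False
  \<comment> \<open>The unit vector \<open>J\<close> squares to -1. The elements \<open>P\<close>
    and \<open>Q\<close> are its spectral projections for the eigenvalues i and -i, so
    multiplication by the vector part r J becomes multiplication by ir and -ir.\<close>
  define r J where "r = vector_abs \<Upsilon>" and "J = (1 / complex_of_real r) *s vector_part \<Upsilon>"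
  define P Q where "P = (1 / 2) *s cl_one + (- \<i> / 2) *s J" and "Q = (1 / 2) *s cl_one + (\<i> / 2) *s J"
  have r: "r \<noteq> 0" using False by (simp add: r_def)
  have JJ: "J \<odot> J = - cl_one"
    unfolding J_def cl_mult_smult_left cl_mult_smult_right vector_part_square
    using r by (simp add: r_def[symmetric] vec_eq_iff power2_eq_square)
  have J: "J \<in> cparavectors" unfolding J_def by (intro cparavectors_smult vector_part_cparavectors)
  have basis: "a *s P + b *s Q = ((a + b) / 2) *s cl_one + (\<i> * (b - a) / 2) *s J" for a b
    unfolding P_def Q_def by (simp add: vec_eq_iff field_simps)
  have prod: "(a *s cl_one + b *s J) \<odot> (c *s cl_one + d *s J)
      = (a * c - b * d) *s cl_one + (a * d + b * c) *s J" for a b c d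
    by (simp add: cl_mult_add_left cl_mult_add_right cl_mult_smult_left cl_mult_smult_right JJ)
       (simp add: vec_eq_iff algebra_simps)
  let ?x = "scalar_part \<Upsilon>"
  have "spectral_decomposition \<Upsilon> P Q (Complex ?x r) (Complex ?x (- r))"
  proof
    show "P \<in> cparavectors" "Q \<in> cparavectors"
      unfolding P_def Q_def by (intro cparavectors_add cparavectors_smult cparavectors_one J)+
    show "(a *s P + b *s Q) \<odot> (c *s P + d *s Q) = (a * c) *s P + (b * d) *s Q" for a b c d
    proof -
      have *: "x = x' \<Longrightarrow> y = y' \<Longrightarrow> x *s cl_one + y *s J = x' *s cl_one + y' *s J" for x x' y y' by simp
      show ?thesis unfolding basis prod
        by (rule *) (simp_all add: field_simps)
    qed
    show "cl_one = P + Q" by (simp add: P_def Q_def vec_eq_iff)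
    have "Complex ?x r + Complex ?x (- r) = 2 * of_real ?x"
      "\<i> * (Complex ?x (- r) - Complex ?x r) = 2 * of_real r"
      by (simp_all add: complex_eq_iff)
    then have "Complex ?x r *s P + Complex ?x (- r) *s Q = of_real ?x *s cl_one + of_real r *s J"
      unfolding basis by simp
    also have "of_real r *s J = vector_part \<Upsilon>"
      using r by (simp add: J_def)
    also have "of_real ?x *s cl_one + vector_part \<Upsilon> = \<Upsilon>"
      using paravector_decomp[OF assms] by (simp only: scaleR_eq_smult)
    finally show "\<Upsilon> = Complex ?x r *s P + Complex ?x (- r) *s Q" ..
    show "hpow z \<Upsilon> = (z powr Complex ?x r) *s P + (z powr Complex ?x (- r)) *s Q" for z
    proof (cases "z = 0")
      case True
      then show ?thesis by (simp add: hpow_def)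
    next
      case False
      have l: "Complex ?x r = of_real ?x + \<i> * of_real r" "Complex ?x (- r) = of_real ?x - \<i> * of_real r"
        by (simp_all add: complex_eq_iff)
      have E: "z powr Complex ?x r = z powr of_real ?x * exp (\<i> * (of_real r * ln z))"
        "z powr Complex ?x (- r) = z powr of_real ?x * exp (- \<i> * (of_real r * ln z))"
        using False unfolding l powr_def
        by (simp_all add: algebra_simps exp_add exp_diff exp_minus divide_inverse)
      \<comment> \<open>Euler's formulas: the coefficients of \<open>cl_one\<close> and
        \<open>J\<close> are the half sum and a half difference of the two conjugate-looking
        exponentials, that is, the cosine and the sine in \<open>hpow\<close>.\<close>
      have "(z powr Complex ?x r + z powr Complex ?x (- r)) / 2 = z powr of_real ?x * cos (of_real r * ln z)"
        unfolding E cos_exp_eq by (simp add: field_simps)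
      moreover have "\<i> * (z powr Complex ?x (- r) - z powr Complex ?x r) / 2
          = z powr of_real ?x * sin (of_real r * ln z)"
        unfolding E sin_exp_eq by (simp add: field_simps)
      ultimately show ?thesis
        using False unfolding basis hpow_def r_def[symmetric] J_def
        by (simp add: vec_eq_iff scaleR_eq_smult algebra_simps)
    qed
  qed simp_all
  then show ?thesis by blast
qed

section \<open>The differential equation\<close>

context spectral_decomposition
begin

lemma hbinom: "hbinom \<Upsilon> k = (l gchoose k) *s P + (m gchoose k) *s Q"
proof -
  have "cl_ffact \<Upsilon> k = (\<Prod>i<k. l - of_nat i) *s P + (\<Prod>i<k. m - of_nat i) *s Q"
  proof (induction k)
    case 0
    show ?case by (simp add: one)
  next
    case (Suc k)
    have "\<Upsilon> - real k *\<^sub>R cl_one = (l - of_nat k) *s P + (m - of_nat k) *s Q"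
      by (subst decomp) (simp add: one vec_eq_iff scaleR_eq_smult algebra_simps)
    then show ?case
      by (simp only: cl_ffact.simps Suc.IH mult prod.lessThan_Suc)
  qed
  then show ?thesis
    by (simp add: hbinom_def gbinomial_prod_rev vec_eq_iff scaleR_eq_smult field_simps atLeast0LessThan)
qed

text \<open>The inverse Fourier transform of the function defining the spline, written out in
  components; it serves as witness for the definite description.\<close>

definition bspline_distr :: "'n distr" where
  "bspline_distr = on_schwartz (\<lambda>f. (\<integral>x. inv_fourier f x * Omega x powr l \<partial>lborel) *s P
     + (\<integral>x. inv_fourier f x * Omega x powr m \<partial>lborel) *s Q)"

definition dirac_series :: "'n distr" where
  "dirac_series = on_schwartz (\<lambda>f. (\<Sum>k. f (real k) * ((-1) ^ k * (l gchoose k))) *s P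
     + (\<Sum>k. f (real k) * ((-1) ^ k * (m gchoose k))) *s Q)"

context
  assumes pos: "scalar_part \<Upsilon> > 0"
begin

lemma Re_pos: "Re l > 0" "Re m > 0"
  using pos Re by simp_all

lemma tempered_bspline_distr: "tempered bspline_distr"
  unfolding bspline_distr_def
  by (intro tempered_combination P Q Re_pos
      scalar_tempered_integral_inv_fourier[OF Omega_powr_measurable norm_Omega_powr_le])

lemma hpow_mult:
  "hpow (\<i> * of_real \<omega>) \<Upsilon> \<odot> hpow (Omega \<omega>) \<Upsilon>
    = ((\<i> * of_real \<omega>) powr l * Omega \<omega> powr l) *s P + ((\<i> * of_real \<omega>) powr m * Omega \<omega> powr m) *s Q"
  unfolding hpow mult ..

lemma poly_growth_hpow_Omega: "poly_growth (\<lambda>\<omega>. hpow (Omega \<omega>) \<Upsilon>)"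
  unfolding hpow
  by (rule poly_growth_combination[OF Omega_powr_measurable norm_Omega_powr_le[OF Re_pos(1)]
      Omega_powr_measurable norm_Omega_powr_le[OF Re_pos(2)] P Q])

lemma poly_growth_hpow_mult: "poly_growth (\<lambda>\<omega>. hpow (\<i> * of_real \<omega>) \<Upsilon> \<odot> hpow (Omega \<omega>) \<Upsilon>)"
  unfolding hpow_mult
  by (rule poly_growth_combination[OF _ norm_i_powr_mult_Omega_powr_le[OF Re_pos(1)]
      _ norm_i_powr_mult_Omega_powr_le[OF Re_pos(2)] P Q]) measurable

lemma fourier_bspline_distr: "fourier_distr bspline_distr = distr_of (\<lambda>\<omega>. hpow (Omega \<omega>) \<Upsilon>)"
proof -
  have "distr_of (\<lambda>\<omega>. hpow (Omega \<omega>) \<Upsilon>) =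
    on_schwartz (\<lambda>f. (\<integral>x. f x * Omega x powr l \<partial>lborel) *s P + (\<integral>x. f x * Omega x powr m \<partial>lborel) *s Q)"
    unfolding hpow
    by (rule distr_of_combination[OF Omega_powr_measurable norm_Omega_powr_le[OF Re_pos(1)]
        Omega_powr_measurable norm_Omega_powr_le[OF Re_pos(2)]])
  then show ?thesis
    by (simp add: fourier_distr_def on_schwartz_def bspline_distr_def fun_eq_iff fourier_schwartz
        inv_fourier_fourier)
qed

lemma bspline_eq: "bspline \<Upsilon> = bspline_distr"
  unfolding bspline_def
proof (rule the_equality)
  show "tempered bspline_distr \<and> fourier_distr bspline_distr = distr_of (\<lambda>\<omega>. hpow (Omega \<omega>) \<Upsilon>)"
    using tempered_bspline_distr fourier_bspline_distr by blast
  show "B = bspline_distr" if "tempered B \<and> fourier_distr B = distr_of (\<lambda>\<omega>. hpow (Omega \<omega>) \<Upsilon>)" for B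
    using that tempered_bspline_distr fourier_bspline_distr by (auto intro: fourier_distr_inject)
qed

lemma summable_coeffs: "Re a > 0 \<Longrightarrow> summable (\<lambda>k. norm ((-1) ^ k * (a gchoose k)))"
  using summable_norm_gbinomial[of a] by (simp add: norm_mult norm_power)

lemma tempered_dirac_series: "tempered dirac_series"
  unfolding dirac_series_def
  by (intro tempered_combination P Q scalar_tempered_series summable_coeffs Re_pos)

text \<open>The modulus of the k-th term is \<open>norm (f x)\<close> times that of the k-th
  coefficient, so absolute convergence of the sum of integrals factors into an L1 norm and an l1
  norm. The binomial series is summed almost everywhere.\<close>

lemma fourier_series_eq_integral:
  assumes f: "f \<in> schwartz" and a: "Re a > 0"
  shows "(\<Sum>k. fourier f (real k) * ((-1) ^ k * (a gchoose k)))
    = (\<integral>\<omega>. f \<omega> * ((\<i> * of_real \<omega>) powr a * Omega \<omega> powr a) \<partial>lborel)"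
proof -
  let ?c = "\<lambda>k. (-1) ^ k * (a gchoose k)"
  let ?e = "\<lambda>x k. exp (- (\<i> * complex_of_real x * complex_of_real (real k)))"
  have int: "integrable lborel (\<lambda>x. f x * ?e x k)" for k
    by (rule integrable_mult_fourier_kernel[OF schwartz_integrable[OF f]])
  have n: "norm (f x * ?e x k * ?c k) = norm (f x) * norm (?c k)" for x k
    by (simp only: norm_mult[of "f x * ?e x k"] norm_mult[of "f x"] norm_fourier_kernel mult_1_right)
  have "(\<Sum>k. fourier f (real k) * ?c k) = (\<Sum>k. \<integral>x. f x * ?e x k * ?c k \<partial>lborel)"
    unfolding fourier_def by (simp only: integral_mult_left_zero)
  also have "\<dots> = (\<integral>x. (\<Sum>k. f x * ?e x k * ?c k) \<partial>lborel)"
  proof (rule integral_suminf[symmetric])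
    show "integrable lborel (\<lambda>x. f x * ?e x k * ?c k)" for k
      by (intro integrable_mult_left int)
    show "AE x in lborel. summable (\<lambda>k. norm (f x * ?e x k * ?c k))"
      unfolding n by (intro AE_I2 summable_mult summable_coeffs a)
    show "summable (\<lambda>k. \<integral>x. norm (f x * ?e x k * ?c k) \<partial>lborel)"
      unfolding n integral_mult_left_zero by (intro summable_mult summable_coeffs a)
  qed
  also have "\<dots> = (\<integral>\<omega>. f \<omega> * ((\<i> * of_real \<omega>) powr a * Omega \<omega> powr a) \<partial>lborel)"
  proof (rule integral_cong_AE)
    have [measurable]: "f \<in> borel_measurable borel" using f by (rule schwartz_measurable)
    show "(\<lambda>x. \<Sum>k. f x * ?e x k * ?c k) \<in> borel_measurable lborel" by measurable
    show "(\<lambda>\<omega>. f \<omega> * ((\<i> * of_real \<omega>) powr a * Omega \<omega> powr a)) \<in> borel_measurable lborel" by measurable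
    show "AE x in lborel. (\<Sum>k. f x * ?e x k * ?c k) = f x * ((\<i> * of_real x) powr a * Omega x powr a)"
      using AE_exp_minus_i_neq_1
    proof eventually_elim
      case (elim x)
      from sums_mult[OF i_powr_mult_Omega_powr_sums[OF a elim], of "f x"]
      show ?case by (intro sums_unique[symmetric]) (simp add: mult_ac)
    qed
  qed
  finally show ?thesis .
qed

lemma fourier_dirac_series:
  "fourier_distr dirac_series = distr_of (\<lambda>\<omega>. hpow (\<i> * of_real \<omega>) \<Upsilon> \<odot> hpow (Omega \<omega>) \<Upsilon>)"
proof -
  have "distr_of (\<lambda>\<omega>. hpow (\<i> * of_real \<omega>) \<Upsilon> \<odot> hpow (Omega \<omega>) \<Upsilon>) =
    on_schwartz (\<lambda>f. (\<integral>\<omega>. f \<omega> * ((\<i> * of_real \<omega>) powr l * Omega \<omega> powr l) \<partial>lborel) *s P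
      + (\<integral>\<omega>. f \<omega> * ((\<i> * of_real \<omega>) powr m * Omega \<omega> powr m) \<partial>lborel) *s Q)"
    unfolding hpow_mult
    by (rule distr_of_combination[OF _ norm_i_powr_mult_Omega_powr_le[OF Re_pos(1)]
        _ norm_i_powr_mult_Omega_powr_le[OF Re_pos(2)]]) measurable
  then show ?thesis
    by (simp add: fourier_distr_def on_schwartz_def dirac_series_def fun_eq_iff fourier_schwartz
        fourier_series_eq_integral Re_pos)
qed

lemma frac_deriv_bspline: "frac_deriv \<Upsilon> (bspline \<Upsilon>) = dirac_series"
  unfolding frac_deriv_def
proof (rule the_equality)
  show "tempered dirac_series \<and>
    (\<exists>g. poly_growth g \<and> fourier_distr (bspline \<Upsilon>) = distr_of g \<and>
         poly_growth (\<lambda>\<omega>. hpow (\<i> * of_real \<omega>) \<Upsilon> \<odot> g \<omega>) \<and>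
         fourier_distr dirac_series = distr_of (\<lambda>\<omega>. hpow (\<i> * of_real \<omega>) \<Upsilon> \<odot> g \<omega>))"
    unfolding bspline_eq
    by (intro conjI exI[of _ "\<lambda>\<omega>. hpow (Omega \<omega>) \<Upsilon>"] tempered_dirac_series poly_growth_hpow_Omega
        fourier_bspline_distr poly_growth_hpow_mult fourier_dirac_series)
next
  fix D
  assume "tempered D \<and>
    (\<exists>g. poly_growth g \<and> fourier_distr (bspline \<Upsilon>) = distr_of g \<and>
         poly_growth (\<lambda>\<omega>. hpow (\<i> * of_real \<omega>) \<Upsilon> \<odot> g \<omega>) \<and>
         fourier_distr D = distr_of (\<lambda>\<omega>. hpow (\<i> * of_real \<omega>) \<Upsilon> \<odot> g \<omega>))"
  then obtain g where D: "tempered D" and g: "poly_growth g"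
      "poly_growth (\<lambda>\<omega>. hpow (\<i> * of_real \<omega>) \<Upsilon> \<odot> g \<omega>)"
      "fourier_distr D = distr_of (\<lambda>\<omega>. hpow (\<i> * of_real \<omega>) \<Upsilon> \<odot> g \<omega>)"
    and bspline: "fourier_distr (bspline \<Upsilon>) = distr_of g"
    by (elim conjE exE) (rule that; assumption)
  have eq: "distr_of g = distr_of (\<lambda>\<omega>. hpow (Omega \<omega>) \<Upsilon>)"
    using bspline by (simp only: bspline_eq fourier_bspline_distr)
  \<comment> \<open>Any admissible \<open>g\<close> may differ from the chosen representative, but
    only on a null set; multiplication by the power of \<open>\<i> * of_real \<omega>\<close>
    preserves this, so both products define the same distribution.\<close>
  have "AE \<omega> in lborel. g \<omega> = hpow (Omega \<omega>) \<Upsilon>"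
    by (rule distr_of_inject_AE[OF g(1) poly_growth_hpow_Omega eq])
  then have "AE \<omega> in lborel. hpow (\<i> * of_real \<omega>) \<Upsilon> \<odot> g \<omega>
      = hpow (\<i> * of_real \<omega>) \<Upsilon> \<odot> hpow (Omega \<omega>) \<Upsilon>"
    by eventually_elim simp
  then have "fourier_distr D = fourier_distr dirac_series"
    unfolding g(3) fourier_dirac_series by (rule distr_of_cong_AE[OF g(2) poly_growth_hpow_mult])
  then show "D = dirac_series"
    by (rule fourier_distr_inject[OF D tempered_dirac_series])
qed

lemma dirac_term_eq:
  "distr_mult ((-1) ^ k *\<^sub>R hbinom \<Upsilon> k) (dirac (real k))
    = on_schwartz (\<lambda>f. (f (real k) * ((-1) ^ k * (l gchoose k))) *s P
        + (f (real k) * ((-1) ^ k * (m gchoose k))) *s Q)"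
  by (auto simp: fun_eq_iff distr_mult_def dirac_def on_schwartz_def hbinom cl_mult_smult_right
      vec_eq_iff scaleR_eq_smult algebra_simps)

lemma dirac_series_sums:
  "(\<lambda>k. distr_mult ((-1) ^ k *\<^sub>R hbinom \<Upsilon> k) (dirac (real k))) distr_sums dirac_series"
  unfolding distr_sums_def
proof (intro conjI allI ballI)
  show "tempered (distr_mult ((-1) ^ k *\<^sub>R hbinom \<Upsilon> k) (dirac (real k)))" for k
    unfolding dirac_term_eq by (intro tempered_combination P Q scalar_tempered_eval)
  fix f assume f: "f \<in> schwartz"
  have "(\<lambda>k. (f (real k) * ((-1) ^ k * (a gchoose k))) *s R)
      sums ((\<Sum>k. f (real k) * ((-1) ^ k * (a gchoose k))) *s R)" if "Re a > 0" for a and R :: "'n cliff"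
    by (rule bounded_linear.sums[OF bounded_linear_smult_left])
       (rule summable_sums[OF summable_norm_cancel[OF schwartz_series_summable(1)[OF f summable_coeffs[OF that]]]])
  then show "(\<lambda>k. distr_mult ((-1) ^ k *\<^sub>R hbinom \<Upsilon> k) (dirac (real k)) f) sums dirac_series f"
    unfolding dirac_term_eq dirac_series_def using f Re_pos by (simp add: on_schwartz_def sums_add)
qed (rule tempered_dirac_series)

end

end

theorem corollary1:
  fixes \<Upsilon> :: "'n::{finite,linorder} cliff"
  assumes "CARD('n) > 2"
    and "\<Upsilon> \<in> paravectors"
    and "scalar_part \<Upsilon> > 1"
  shows "(\<lambda>k. distr_mult ((-1) ^ k *\<^sub>R hbinom \<Upsilon> k) (dirac (real k)))
           distr_sums frac_deriv \<Upsilon> (bspline \<Upsilon>)"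
proof -
  from spectral_decomposition_exists[OF assms(2)] obtain P Q l m
    where "spectral_decomposition \<Upsilon> P Q l m" by blast
  then interpret spectral_decomposition \<Upsilon> P Q l m .
  have "scalar_part \<Upsilon> > 0" using assms(3) by simp
  then show ?thesis
    using dirac_series_sums frac_deriv_bspline by simp
qed

end
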